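(* Let $G$ be a connected 1-walk-regular graph. For any graph $H$, $G\cong_{\mathcal S_+}H$ if and only if $H$ is a connected 1-walk-regular graph that is cospectral to $G$.
   Context: Graphs are finite, simple and undirected; $A_G$ is the adjacency matrix of $G$. Two graphs are cospectral if their adjacency matrices have the same multiset of eigenvalues. With $\bullet$ the entrywise (Schur) product, a graph $G$ is walk-regular if for every $\ell\in\mathbb N$ there is $a_\ell\in\mathbb N$ with $I\bullet A_G^\ell=a_\ell I$; it is 1-walk-regular if it is walk-regular and for every $\ell\in\mathbb N$ there is $b_\ell\in\mathbb N$ with $A_G\bullet A_G^\ell=b_\ell A_G$. For vertices $x,y$ of the same graph, $\mathrm{rel}(x,y)$ denotes their relationship: equal, adjacent, or distinct non-adjacent. $\mathcal S_+$ is the cone of (Hermitian) positive semidefinite matrices. $G\cong_{\mathcal S_+}H$ means: there is $M\in\mathcal S_+$ with rows and columns indexed by $V_G\times V_H$ such that $\sum_{h,h'\in V_H}M_{gh,g'h'}=1$ for all $g,g'\in V_G$; $\sum_{g,g'\in V_G}M_{gh,g'h'}=1$ for all $h,h'\in V_H$; and $M_{gh,g'h'}=0$ whenever $\mathrm{rel}(g,g')\neq\mathrm{rel}(h,h')$. *)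

theory Defs
  imports
    "HOL-Analysis.Analysis"
    "Jordan_Normal_Form.Char_Poly"
    "Graph_Theory.Graph_Theory"
begin

text \<open>A finite simple undirected graph is a \<open>pair_graph\<close> of \<open>Graph_Theory\<close>: finite vertex set,
  symmetric loop-free arc relation. Its notion of connectedness excludes the graph without
  vertices.\<close>

text \<open>\<open>from_nat_into S\<close> enumerates a finite set \<open>S\<close> bijectively by \<open>{..<card S}\<close>; the matrix
  depends on this arbitrary choice only up to simultaneous permutation of rows and columns.\<close>

definition adj_mat :: "'a pair_pre_digraph \<Rightarrow> complex mat" where
  "adj_mat G = (let n = card (pverts G); v = from_nat_into (pverts G) in
     mat n n (\<lambda>(i, j). if (v i, v j) \<in> parcs G then 1 else 0))"

definition schur_prod :: "'a::times mat \<Rightarrow> 'a mat \<Rightarrow> 'a mat" (infixl \<open>\<bullet>\<^sub>m\<close> 70) where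
  "A \<bullet>\<^sub>m B = mat (dim_row A) (dim_col A) (\<lambda>(i, j). A $$ (i, j) * B $$ (i, j))"

text \<open>The roots of the complex characteristic polynomial, with multiplicity.\<close>

definition eigenvalue_mset :: "complex mat \<Rightarrow> complex multiset" where
  "eigenvalue_mset A = proots (char_poly A)"

definition cospectral :: "'a pair_pre_digraph \<Rightarrow> 'b pair_pre_digraph \<Rightarrow> bool" where
  "cospectral G H \<longleftrightarrow> eigenvalue_mset (adj_mat G) = eigenvalue_mset (adj_mat H)"

definition walk_regular :: "'a pair_pre_digraph \<Rightarrow> bool" where
  "walk_regular G \<longleftrightarrow> (\<forall>l::nat. \<exists>a::nat.
     1\<^sub>m (card (pverts G)) \<bullet>\<^sub>m (adj_mat G ^\<^sub>m l) = of_nat a \<cdot>\<^sub>m 1\<^sub>m (card (pverts G)))"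

definition one_walk_regular :: "'a pair_pre_digraph \<Rightarrow> bool" where
  "one_walk_regular G \<longleftrightarrow> walk_regular G \<and>
     (\<forall>l::nat. \<exists>b::nat. adj_mat G \<bullet>\<^sub>m (adj_mat G ^\<^sub>m l) = of_nat b \<cdot>\<^sub>m adj_mat G)"

datatype vertex_relationship = Equal | Adjacent | Distinct_Nonadjacent

definition rel :: "'a pair_pre_digraph \<Rightarrow> 'a \<Rightarrow> 'a \<Rightarrow> vertex_relationship" where
  "rel G x y = (if x = y then Equal
                else if (x, y) \<in> parcs G then Adjacent
                else Distinct_Nonadjacent)"

text \<open>Matrices with rows and columns indexed by a finite set \<open>I\<close> are functions of which only the
  values on \<open>I\<close> matter. The quadratic form of a Hermitian matrix is real, so taking \<open>Re\<close> merely
  turns the complex number into a real one.\<close>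

definition psd_on :: "'i set \<Rightarrow> ('i \<Rightarrow> 'i \<Rightarrow> complex) \<Rightarrow> bool" where
  "psd_on I M \<longleftrightarrow>
     (\<forall>i\<in>I. \<forall>j\<in>I. M j i = cnj (M i j)) \<and>
     (\<forall>x. 0 \<le> Re (\<Sum>i\<in>I. \<Sum>j\<in>I. cnj (x i) * M i j * x j))"

definition psd_isomorphic :: "'a pair_pre_digraph \<Rightarrow> 'b pair_pre_digraph \<Rightarrow> bool"
    (infix \<open>\<cong>\<^sub>S\<^sub>+\<close> 50) where
  "G \<cong>\<^sub>S\<^sub>+ H \<longleftrightarrow> (\<exists>M :: 'a \<times> 'b \<Rightarrow> 'a \<times> 'b \<Rightarrow> complex.
     psd_on (pverts G \<times> pverts H) M \<and>
     (\<forall>g\<in>pverts G. \<forall>g'\<in>pverts G. (\<Sum>h\<in>pverts H. \<Sum>h'\<in>pverts H. M (g, h) (g', h')) = 1) \<and>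
     (\<forall>h\<in>pverts H. \<forall>h'\<in>pverts H. (\<Sum>g\<in>pverts G. \<Sum>g'\<in>pverts G. M (g, h) (g', h')) = 1) \<and>
     (\<forall>g\<in>pverts G. \<forall>g'\<in>pverts G. \<forall>h\<in>pverts H. \<forall>h'\<in>pverts H.
        rel G g g' \<noteq> rel H h h' \<longrightarrow> M (g, h) (g', h') = 0))"

end

theory Submission
  imports Defs "Jordan_Normal_Form.Schur_Decomposition"
begin

text \<open>Write \<open>A\<close>, \<open>B\<close> for the adjacency matrices of \<open>G\<close>, \<open>H\<close>.

If \<open>G\<close> and \<open>H\<close> are connected, 1-walk-regular and cospectral, let \<open>E\<^sub>c\<close>, \<open>F\<^sub>c\<close> be the spectral
projections of \<open>A\<close>, \<open>B\<close> for the eigenvalue \<open>c\<close> of multiplicity \<open>m\<^sub>c\<close>, and put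
\<open>M = \<Sum>\<^sub>c (1 / m\<^sub>c) E\<^sub>c \<otimes> F\<^sub>c\<close>. As \<open>E\<^sub>c\<close> is a polynomial in \<open>A\<close>, its diagonal is constantly \<open>m\<^sub>c / n\<close>
and its entries on arcs are constantly \<open>c m\<^sub>c\<close> divided by the number of arcs. Hence an equal
pair in \<open>G\<close> makes the entry of \<open>M\<close> a multiple of \<open>\<Sum>\<^sub>c F\<^sub>c = I\<close> and an adjacent one a multiple of
\<open>\<Sum>\<^sub>c c F\<^sub>c = B\<close>, which gives the zero pattern. The sums are 1 because the projection for the
valency is \<open>J / n\<close>, \<open>J\<close> the all-ones matrix, and the others have zero row sums.

Conversely, \<open>M\<close> is the Choi matrix of a completely positive, unital and trace-preserving map
\<open>\<Phi>\<close> with \<open>\<Phi>(A) = B\<close>, and \<open>tr A\<^sup>2 = tr B\<^sup>2\<close> puts \<open>A\<close> into its multiplicative domain. Concretely,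
the quadratic form of \<open>M\<close> vanishes at vectors that express an intertwining relation between \<open>A\<close>
and \<open>B\<close>, so \<open>M\<close> annihilates them. It follows that \<open>\<Phi>\<close> maps \<open>A\<^sup>l\<close> to \<open>B\<^sup>l\<close>, and all diagonal and
arc entries of the powers are carried over from \<open>G\<close> to \<open>H\<close>.\<close>

section \<open>The spectral theorem\<close>

text \<open>The enumeration is that of \<open>adj_mat\<close>, so \<open>adj_mat G\<close> is an
  instance and the proof can work with functions on vertices.\<close>

definition indexed_mat :: "'a set \<Rightarrow> ('a \<Rightarrow> 'a \<Rightarrow> complex) \<Rightarrow> complex mat" where
  "indexed_mat V A = mat (card V) (card V) (\<lambda>(i, j). A (from_nat_into V i) (from_nat_into V j))"

lemma indexed_mat_carrier [simp]: "indexed_mat V A \<in> carrier_mat (card V) (card V)"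
  by (simp add: indexed_mat_def)

lemma sum_from_nat_into:
  assumes "finite V"
  shows "(\<Sum>x\<in>V. f x) = (\<Sum>i<card V. f (from_nat_into V i))"
  using sum.reindex_bij_betw[OF bij_betw_from_nat_into_finite[OF assms], of f] by simp

lemma from_nat_into_in: "i < card V \<Longrightarrow> from_nat_into V i \<in> V"
  by (metis card.empty from_nat_into not_less_zero)

lemma obtain_index:
  assumes "finite V" "x \<in> V"
  obtains i where "i < card V" "x = from_nat_into V i"
  using bij_betw_from_nat_into_finite[OF assms(1)] assms(2)
  by (auto simp: bij_betw_def)

text \<open>The trace of the square is the squared Frobenius norm for a Hermitian matrix and the
  sum of the squared eigenvalues for any matrix.\<close>

lemma nonzero_hermitian_eigenvector:
  assumes fin: "finite V"
    and herm: "\<And>x y. x \<in> V \<Longrightarrow> y \<in> V \<Longrightarrow> A y x = cnj (A x y)"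
    and nz: "\<exists>x\<in>V. \<exists>y\<in>V. A x y \<noteq> 0"
  shows "\<exists>e f. e \<noteq> 0 \<and> (\<exists>x\<in>V. f x \<noteq> 0) \<and> (\<forall>x\<in>V. (\<Sum>y\<in>V. A x y * f y) = e * f x)"
proof -
  define n where "n = card V"
  define v where "v = from_nat_into V"
  define C where "C = indexed_mat V A"
  have C: "C \<in> carrier_mat n n" and Cij: "\<And>i j. i < n \<Longrightarrow> j < n \<Longrightarrow> C $$ (i, j) = A (v i) (v j)"
    by (auto simp: C_def n_def v_def indexed_mat_def)
  have bij: "bij_betw v {..<n} V"
    unfolding v_def n_def by (rule bij_betw_from_nat_into_finite[OF fin])
  have vV: "v i \<in> V" if "i < n" for i
    using bij that by (auto simp: bij_betw_def)
  obtain es where es: "char_poly C = (\<Prod>a\<leftarrow>es. [:- a, 1:])" and "length es = n"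
    using char_poly_factorized[OF C] by blast
  obtain B where B: "B \<in> carrier_mat n n" "upper_triangular B" "similar_mat C B"
    using schur_decomposition_exists[OF C es] by blast
  obtain P Q where "similar_mat_wit C B P Q"
    using B(3) unfolding similar_mat_def by blast
  note PQ = similar_mat_witD2(6,7,2,3)[OF C this]
  have cp: "char_poly C = (\<Prod>a\<leftarrow>diag_mat B. [:- a, 1:])"
    using char_poly_similar[OF B(3)] char_poly_upper_triangular[OF B(1,2)] by simp
  have QP: "Q * (P * X) = X" if "X \<in> carrier_mat n n" for X
    using assoc_mult_mat[OF PQ(2,1) that] PQ(3) that by simp
  note assoc = assoc_mult_mat[of _ n n _ n _ n]
  have CC: "C * C = P * ((B * B) * Q)"
    using PQ(1,2) B(1) by (simp add: PQ(4) assoc QP)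
  have tr_comm: "(\<Sum>i<n. (X * Y) $$ (i, i)) = (\<Sum>i<n. (Y * X) $$ (i, i))"
    if "X \<in> carrier_mat n n" "Y \<in> carrier_mat n n" for X Y :: "complex mat"
  proof -
    have "(\<Sum>i<n. (X * Y) $$ (i, i)) = (\<Sum>i<n. \<Sum>j<n. X $$ (i, j) * Y $$ (j, i))"
      using that by (intro sum.cong refl) (simp add: scalar_prod_def lessThan_atLeast0)
    also have "\<dots> = (\<Sum>i<n. \<Sum>j<n. Y $$ (i, j) * X $$ (j, i))"
      by (subst sum.swap) (simp add: mult.commute)
    also have "\<dots> = (\<Sum>i<n. (Y * X) $$ (i, i))"
      using that by (intro sum.cong refl) (simp add: scalar_prod_def lessThan_atLeast0)
    finally show ?thesis .
  qed
  have "(B * B) * Q * P = B * B"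
    using PQ(1,2,3) B(1) by (simp add: assoc)
  then have trCB: "(\<Sum>i<n. (C * C) $$ (i, i)) = (\<Sum>i<n. (B * B) $$ (i, i))"
    unfolding CC using tr_comm[of P "(B * B) * Q"] PQ(1,2) B(1) by (metis mult_carrier_mat)
  have trC: "(\<Sum>i<n. (C * C) $$ (i, i)) = of_real (\<Sum>i<n. \<Sum>j<n. (cmod (C $$ (i, j)))\<^sup>2)"
  proof -
    have "(C * C) $$ (i, i) = (\<Sum>j<n. of_real ((cmod (C $$ (i, j)))\<^sup>2))" if "i < n" for i
    proof -
      have "(C * C) $$ (i, i) = (\<Sum>j<n. C $$ (i, j) * C $$ (j, i))"
        using that C by (simp add: scalar_prod_def lessThan_atLeast0)
      also have "\<dots> = (\<Sum>j<n. of_real ((cmod (C $$ (i, j)))\<^sup>2))"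
      proof (rule sum.cong[OF refl])
        fix j assume "j \<in> {..<n}"
        then have "C $$ (j, i) = cnj (C $$ (i, j))"
          using that herm[OF vV vV, of i j] by (simp add: Cij)
        then show "C $$ (i, j) * C $$ (j, i) = of_real ((cmod (C $$ (i, j)))\<^sup>2)"
          using complex_norm_square[of "C $$ (i, j)"] by simp
      qed
      finally show ?thesis .
    qed
    then show ?thesis by simp
  qed
  \<comment> \<open>With a zero diagonal, \<open>B\<close> would be strictly upper triangular and
    \<open>B * B\<close> would have zero diagonal. By the two trace identities the Frobenius norm of
    \<open>C\<close>, hence \<open>A\<close> on \<open>V\<close>, would then vanish.\<close>
  have "\<exists>e. e \<in> set (diag_mat B) \<and> e \<noteq> 0"
  proof (rule ccontr)
    assume "\<not> ?thesis"
    then have B0: "B $$ (i, i) = 0" if "i < n" for i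
      using that B(1) by (auto simp: diag_mat_def)
    have "(B * B) $$ (i, i) = 0" if "i < n" for i
    proof -
      have "(B * B) $$ (i, i) = (\<Sum>j<n. B $$ (i, j) * B $$ (j, i))"
        using that B by (simp add: scalar_prod_def lessThan_atLeast0)
      also have "\<dots> = 0"
      proof (rule sum.neutral, rule ballI)
        fix j assume "j \<in> {..<n}"
        then show "B $$ (i, j) * B $$ (j, i) = 0"
          using that B0[of i] B(1) upper_triangularD[OF B(2)]
          by (cases i j rule: linorder_cases) auto
      qed
      finally show ?thesis .
    qed
    then have "(\<Sum>i<n. \<Sum>j<n. (cmod (C $$ (i, j)))\<^sup>2) = 0"
      using trCB trC by (metis (no_types, lifting) lessThan_iff of_real_eq_0_iff sum.neutral)
    then have "\<forall>i<n. \<forall>j<n. C $$ (i, j) = 0"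
      by (simp add: sum_nonneg_eq_0_iff sum_nonneg)
    then have "\<forall>x\<in>V. \<forall>y\<in>V. A x y = 0"
      using bij Cij unfolding bij_betw_def by (metis imageE lessThan_iff)
    then show False using nz by blast
  qed
  then obtain e where e: "e \<in> set (diag_mat B)" "e \<noteq> 0" by blast
  have "poly (char_poly C) e = 0"
    unfolding cp using e(1) by (simp add: poly_prod_list prod_list_zero_iff image_iff)
  then have "eigenvalue C e" using eigenvalue_root_char_poly[OF C] by simp
  then obtain x where x: "x \<in> carrier_vec n" "x \<noteq> 0\<^sub>v n" "C *\<^sub>v x = e \<cdot>\<^sub>v x"
    using C by (auto simp: eigenvalue_def eigenvector_def)
  define f where "f = (\<lambda>y. vec_index x (the_inv_into {..<n} v y))"
  have fv: "f (v i) = vec_index x i" if "i < n" for i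
    using that the_inv_into_f_f[OF bij_betw_imp_inj_on[OF bij]] by (simp add: f_def)
  have "\<exists>i<n. vec_index x i \<noteq> 0"
  proof (rule ccontr)
    assume "\<not> ?thesis"
    then have "x = 0\<^sub>v n" using x(1) by (intro eq_vecI) auto
    then show False using x(2) by simp
  qed
  then have "\<exists>x\<in>V. f x \<noteq> 0" using fv vV by metis
  moreover have "(\<Sum>y\<in>V. A z y * f y) = e * f z" if "z \<in> V" for z
  proof -
    obtain i where i: "i < n" "z = v i" using bij \<open>z \<in> V\<close> by (auto simp: bij_betw_def)
    have "(\<Sum>y\<in>V. A z y * f y) = (\<Sum>j<n. A z (v j) * f (v j))"
      using sum.reindex_bij_betw[OF bij, of "\<lambda>y. A z y * f y"] by simp
    also have "\<dots> = (\<Sum>j<n. C $$ (i, j) * vec_index x j)" using i by (simp add: Cij fv)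
    also have "\<dots> = vec_index (C *\<^sub>v x) i"
      using C x(1) i by (simp add: scalar_prod_def lessThan_atLeast0)
    also have "\<dots> = e * f z" using x i by (simp add: fv)
    finally show ?thesis .
  qed
  ultimately show ?thesis using e(2) by blast
qed

section \<open>Orthonormal eigenvectors of a Hermitian matrix\<close>

lemma hermitian_swap:
  fixes f g :: "'a \<Rightarrow> complex"
  assumes "\<And>x y. x \<in> V \<Longrightarrow> y \<in> V \<Longrightarrow> A y x = cnj (A x y)"
  shows "(\<Sum>x\<in>V. cnj (f x) * (\<Sum>y\<in>V. A x y * g y)) = (\<Sum>x\<in>V. cnj (\<Sum>y\<in>V. A x y * f y) * g x)"
proof -
  have "(\<Sum>x\<in>V. cnj (f x) * (\<Sum>y\<in>V. A x y * g y)) = (\<Sum>y\<in>V. \<Sum>x\<in>V. cnj (f x) * (A x y * g y))"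
    unfolding sum_distrib_left by (rule sum.swap)
  also have "\<dots> = (\<Sum>y\<in>V. \<Sum>x\<in>V. cnj (A y x * f x) * g y)"
  proof (intro sum.cong refl)
    fix x y assume "x \<in> V" "y \<in> V"
    from assms[OF this] show "cnj (f y) * (A y x * g x) = cnj (A x y * f y) * g x" by simp
  qed
  also have "\<dots> = (\<Sum>x\<in>V. cnj (\<Sum>y\<in>V. A x y * f y) * g x)"
    by (simp add: sum_distrib_right)
  finally show ?thesis .
qed

lemma sum_cnj_mult_self:
  "(\<Sum>x\<in>V. cnj (f x) * f x) = of_real (\<Sum>x\<in>V. (cmod (f x))\<^sup>2)"
  by (simp add: complex_norm_square mult.commute del: of_real_power)

lemma norm_square_pos:
  assumes "finite V" "\<exists>x\<in>V. f x \<noteq> 0"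
  shows "0 < (\<Sum>x\<in>V. (cmod (f x))\<^sup>2)"
proof -
  obtain x where "x \<in> V" "f x \<noteq> 0" using assms(2) by blast
  then show ?thesis using sum_pos2[OF assms(1), of x "\<lambda>x. (cmod (f x))\<^sup>2"] by simp
qed

lemma hermitian_eigenvalue_real:
  assumes "finite V"
    and "\<And>x y. x \<in> V \<Longrightarrow> y \<in> V \<Longrightarrow> A y x = cnj (A x y)"
    and "\<exists>x\<in>V. f x \<noteq> 0"
    and eig: "\<And>x. x \<in> V \<Longrightarrow> (\<Sum>y\<in>V. A x y * f y) = e * f x"
  shows "e = of_real (Re e)"
proof -
  define s where "s = (\<Sum>x\<in>V. (cmod (f x))\<^sup>2)"
  have "e * (\<Sum>x\<in>V. cnj (f x) * f x) = cnj e * (\<Sum>x\<in>V. cnj (f x) * f x)"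
  proof -
    have "e * (\<Sum>x\<in>V. cnj (f x) * f x) = (\<Sum>x\<in>V. cnj (f x) * (\<Sum>y\<in>V. A x y * f y))"
      unfolding sum_distrib_left[of e] by (intro sum.cong refl) (simp only: eig mult.left_commute)
    also have "\<dots> = (\<Sum>x\<in>V. cnj (\<Sum>y\<in>V. A x y * f y) * f x)"
      by (rule hermitian_swap[OF assms(2)])
    also have "\<dots> = cnj e * (\<Sum>x\<in>V. cnj (f x) * f x)"
      unfolding sum_distrib_left[of "cnj e"]
      by (intro sum.cong refl) (simp only: eig complex_cnj_mult mult.assoc)
    finally show ?thesis .
  qed
  then have "e * of_real s = cnj e * of_real s"
    by (simp only: sum_cnj_mult_self s_def)
  moreover have "s \<noteq> 0" using norm_square_pos[OF assms(1,3)] by (simp add: s_def)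
  ultimately have "e = cnj e" by simp
  then show ?thesis by (metis Reals_cnj_iff of_real_Re)
qed

text \<open>Deflation: the part of \<open>A\<close> that is already diagonalised is subtracted, and
  the next eigenvector is sought orthogonally to the previous ones.\<close>

lemma orthonormal_eigenvectors:
  assumes fin: "finite V"
    and herm: "\<And>x y. x \<in> V \<Longrightarrow> y \<in> V \<Longrightarrow> A y x = cnj (A x y)"
    and "m \<le> card V"
  shows "\<exists>(u :: nat \<Rightarrow> 'a \<Rightarrow> complex) (lam :: nat \<Rightarrow> real).
    (\<forall>i<m. \<forall>j<m. (\<Sum>x\<in>V. cnj (u i x) * u j x) = of_bool (i = j)) \<and>
    (\<forall>i<m. \<forall>x\<in>V. (\<Sum>y\<in>V. A x y * u i y) = of_real (lam i) * u i x)"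
  using \<open>m \<le> card V\<close>
proof (induction m)
  case 0
  show ?case by simp
next
  case (Suc m)
  obtain u :: "nat \<Rightarrow> 'a \<Rightarrow> complex" and lam :: "nat \<Rightarrow> real"
    where ul: "\<forall>i<m. \<forall>j<m. (\<Sum>x\<in>V. cnj (u i x) * u j x) = of_bool (i = j)"
      "\<forall>i<m. \<forall>x\<in>V. (\<Sum>y\<in>V. A x y * u i y) = of_real (lam i) * u i x"
    using Suc.IH[OF Suc_leD[OF Suc.prems]] by (elim exE conjE) (rule that)
  have orth: "(\<Sum>x\<in>V. cnj (u i x) * u j x) = of_bool (i = j)" if "i < m" "j < m" for i j
    using ul(1) that by blast
  have eig: "(\<Sum>y\<in>V. A x y * u i y) = of_real (lam i) * u i x" if "i < m" "x \<in> V" for i x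
    using ul(2) that by blast
  define B where "B = (\<lambda>x y. A x y - (\<Sum>i<m. of_real (lam i) * u i x * cnj (u i y)))"
  have hermB: "B y x = cnj (B x y)" if "x \<in> V" "y \<in> V" for x y
    using herm[OF that] by (simp add: B_def mult_ac)
  have A_apply: "(\<Sum>y\<in>V. A x y * f y)
      = (\<Sum>y\<in>V. B x y * f y) + (\<Sum>i<m. of_real (lam i) * u i x * (\<Sum>y\<in>V. cnj (u i y) * f y))"
    for x f
  proof -
    have "(\<Sum>y\<in>V. A x y * f y)
        = (\<Sum>y\<in>V. B x y * f y) + (\<Sum>y\<in>V. \<Sum>i<m. of_real (lam i) * u i x * cnj (u i y) * f y)"
      unfolding sum.distrib[symmetric] sum_distrib_right[symmetric]
      by (simp add: B_def left_diff_distrib)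
    also have "(\<Sum>y\<in>V. \<Sum>i<m. of_real (lam i) * u i x * cnj (u i y) * f y)
        = (\<Sum>i<m. of_real (lam i) * u i x * (\<Sum>y\<in>V. cnj (u i y) * f y))"
      by (subst sum.swap) (simp add: sum_distrib_left mult_ac)
    finally show ?thesis .
  qed
  have "\<exists>e f. (\<exists>x\<in>V. f x \<noteq> 0) \<and> (\<forall>i<m. (\<Sum>x\<in>V. cnj (u i x) * f x) = 0)
      \<and> (\<forall>x\<in>V. (\<Sum>y\<in>V. B x y * f y) = e * f x)"
  proof (cases "\<exists>x\<in>V. \<exists>y\<in>V. B x y \<noteq> 0")
    case True
    obtain e f where ef: "e \<noteq> 0" "\<exists>x\<in>V. f x \<noteq> 0" "\<And>x. x \<in> V \<Longrightarrow> (\<Sum>y\<in>V. B x y * f y) = e * f x"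
      using nonzero_hermitian_eigenvector[OF fin hermB True] by blast
    \<comment> \<open>\<open>B\<close> annihilates \<open>u j\<close> and is Hermitian, so its image
      is orthogonal to \<open>u j\<close>; as \<open>e\<close> is non-zero, \<open>f\<close> lies in
      that image.\<close>
    have "(\<Sum>x\<in>V. cnj (u j x) * f x) = 0" if j: "j < m" for j
    proof -
      have "(\<Sum>y\<in>V. B x y * u j y) = 0" if "x \<in> V" for x
        using A_apply[of x "u j"] eig[OF j that] orth j
        by (simp add: of_bool_def if_distrib sum.If_cases cong: if_cong)
      then have "(\<Sum>x\<in>V. cnj (u j x) * (\<Sum>y\<in>V. B x y * f y)) = 0"
        using hermitian_swap[of V B "u j" f, OF hermB] by simp
      moreover have "(\<Sum>x\<in>V. cnj (u j x) * (\<Sum>y\<in>V. B x y * f y)) = e * (\<Sum>x\<in>V. cnj (u j x) * f x)"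
        unfolding sum_distrib_left[of e] by (intro sum.cong refl) (simp only: ef(3) mult.left_commute)
      ultimately have "e * (\<Sum>x\<in>V. cnj (u j x) * f x) = 0" by simp
      then show ?thesis using ef(1) by simp
    qed
    then show ?thesis using ef by blast
  next
    case False
    \<comment> \<open>Now \<open>B\<close> is zero on \<open>V\<close>, and any non-zero vector
      orthogonal to the \<open>u i\<close> will do. The \<open>f x\<close> are the columns of the
      projection onto the orthogonal complement; its trace \<open>card V - m\<close> is positive, so
      some column is non-zero.\<close>
    define f where "f = (\<lambda>x y. of_bool (y = x) - (\<Sum>i<m. u i y * cnj (u i x)))"
    have "\<exists>x\<in>V. f x x \<noteq> 0"
    proof (rule ccontr)
      assume "\<not> ?thesis"
      then have "(\<Sum>x\<in>V. f x x) = 0" by simp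
      moreover have "(\<Sum>x\<in>V. f x x) = of_nat (card V) - (\<Sum>i<m. \<Sum>x\<in>V. cnj (u i x) * u i x)"
        by (simp add: f_def sum_subtractf sum.swap[of _ V] mult.commute)
      moreover have "(\<Sum>i<m. \<Sum>x\<in>V. cnj (u i x) * u i x) = of_nat m"
        using orth by simp
      ultimately have "(of_nat (card V) :: complex) = of_nat m" by simp
      then show False using Suc.prems by (simp only: of_nat_eq_iff)
    qed
    then obtain x0 where x0: "x0 \<in> V" "f x0 x0 \<noteq> 0" by blast
    have "(\<Sum>y\<in>V. cnj (u j y) * f x0 y) = 0" if "j < m" for j
    proof -
      have "(\<Sum>y\<in>V. cnj (u j y) * f x0 y) = cnj (u j x0)
          - (\<Sum>y\<in>V. \<Sum>i<m. cnj (u j y) * u i y * cnj (u i x0))"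
      proof -
        have "(\<Sum>y\<in>V. cnj (u j y) * of_bool (y = x0)) = cnj (u j x0)"
          using x0(1) fin by (simp add: of_bool_def if_distrib[of "(*) _"] cong: if_cong)
        then show ?thesis
          by (simp add: f_def right_diff_distrib sum_subtractf sum_distrib_left mult.assoc)
      qed
      also have "(\<Sum>y\<in>V. \<Sum>i<m. cnj (u j y) * u i y * cnj (u i x0))
          = (\<Sum>i<m. (\<Sum>y\<in>V. cnj (u j y) * u i y) * cnj (u i x0))"
        by (subst sum.swap) (simp add: sum_distrib_right)
      also have "\<dots> = (\<Sum>i<m. of_bool (j = i) * cnj (u i x0))"
        by (intro sum.cong refl) (simp add: orth[OF that])
      also have "\<dots> = cnj (u j x0)"
        using that by (simp add: of_bool_def if_distrib[of "\<lambda>c. c * _"] cong: if_cong)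
      finally show ?thesis by simp
    qed
    moreover have "(\<Sum>y\<in>V. B x y * f x0 y) = 0 * f x0 x" if "x \<in> V" for x
      using False that by simp
    ultimately show ?thesis using x0 by blast
  qed
  then obtain e f where f: "\<exists>x\<in>V. f x \<noteq> 0" "\<And>i. i < m \<Longrightarrow> (\<Sum>x\<in>V. cnj (u i x) * f x) = 0"
      "\<And>x. x \<in> V \<Longrightarrow> (\<Sum>y\<in>V. B x y * f y) = e * f x"
    by blast
  have Af: "(\<Sum>y\<in>V. A x y * f y) = e * f x" if "x \<in> V" for x
    using A_apply[of x f] f(2,3) that by simp
  define s where "s = sqrt (\<Sum>x\<in>V. (cmod (f x))\<^sup>2)"
  have s0: "s > 0" using norm_square_pos[OF fin f(1)] by (simp add: s_def)
  define w where "w = (\<lambda>x. f x / of_real s)"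
  have ww: "(\<Sum>x\<in>V. cnj (w x) * w x) = 1"
  proof -
    have "(\<Sum>x\<in>V. cnj (w x) * w x) = (\<Sum>x\<in>V. cnj (f x) * f x) / of_real (s\<^sup>2)"
      by (simp add: w_def sum_divide_distrib power2_eq_square)
    also have "s\<^sup>2 = (\<Sum>x\<in>V. (cmod (f x))\<^sup>2)"
      using norm_square_pos[OF fin f(1)] by (simp add: s_def)
    finally have "(\<Sum>x\<in>V. cnj (w x) * w x) = of_real (\<Sum>x\<in>V. (cmod (f x))\<^sup>2) / of_real (\<Sum>x\<in>V. (cmod (f x))\<^sup>2)"
      by (simp only: sum_cnj_mult_self)
    then show ?thesis
      using norm_square_pos[OF fin f(1)] by (simp del: of_real_sum of_real_power)
  qed
  have uw: "(\<Sum>x\<in>V. cnj (u i x) * w x) = 0" if "i < m" for i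
    using f(2)[OF that] by (simp add: w_def sum_divide_distrib[symmetric])
  have wu: "(\<Sum>x\<in>V. cnj (w x) * u i x) = 0" if "i < m" for i
    using arg_cong[OF uw[OF that], of cnj] by (simp add: mult.commute)
  have Aw: "(\<Sum>y\<in>V. A x y * w y) = of_real (Re e) * w x" if "x \<in> V" for x
    using Af[OF that] hermitian_eigenvalue_real[OF fin herm f(1) Af]
    by (simp add: w_def sum_divide_distrib[symmetric])
  show ?case
    by (rule exI[of _ "u(m := w)"], rule exI[of _ "lam(m := Re e)"])
      (auto simp: less_Suc_eq orth eig ww uw wu Aw)
qed

text \<open>For the matrix with columns \<open>u i\<close>, \<open>orthonormal\<close> and
  \<open>complete\<close> say that its conjugate transpose is a left and a right inverse. Indexing
  by numbers lets \<open>lam\<close> record multiplicities.\<close>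

locale spectral_basis =
  fixes V :: "'a set" and A :: "'a \<Rightarrow> 'a \<Rightarrow> complex"
    and u :: "nat \<Rightarrow> 'a \<Rightarrow> complex" and lam :: "nat \<Rightarrow> real"
  assumes fin: "finite V"
    and hermitian: "\<And>x y. x \<in> V \<Longrightarrow> y \<in> V \<Longrightarrow> A y x = cnj (A x y)"
    and orthonormal: "\<And>i j. i < card V \<Longrightarrow> j < card V \<Longrightarrow>
      (\<Sum>x\<in>V. cnj (u i x) * u j x) = of_bool (i = j)"
    and complete: "\<And>x y. x \<in> V \<Longrightarrow> y \<in> V \<Longrightarrow>
      (\<Sum>i<card V. u i x * cnj (u i y)) = of_bool (x = y)"
    and eigen: "\<And>i x. i < card V \<Longrightarrow> x \<in> V \<Longrightarrow>
      (\<Sum>y\<in>V. A x y * u i y) = of_real (lam i) * u i x"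

lemma proots_linear_factors:
  "proots (\<Prod>a\<leftarrow>xs. [:- a, 1:]) = mset (xs :: 'a::idom list)"
proof (induction xs)
  case (Cons a xs)
  have "(\<Prod>a\<leftarrow>xs. [:- a, 1:]) \<noteq> (0 :: 'a poly)"
    by (auto simp: prod_list_zero_iff)
  then show ?case using Cons by (simp add: proots_mult del: mult_pCons_left)
qed simp

text \<open>In the eigenvector basis the matrix becomes diagonal, and the spectrum with
  multiplicities can be read off the characteristic polynomial of a similar diagonal matrix.\<close>

theorem spectral_theorem:
  assumes fin: "finite V"
    and herm: "\<And>x y. x \<in> V \<Longrightarrow> y \<in> V \<Longrightarrow> A y x = cnj (A x y)"
  obtains u lam where "spectral_basis V A u lam"
    and "eigenvalue_mset (indexed_mat V A)
      = image_mset (\<lambda>i. complex_of_real (lam i)) (mset_set {..<card V})"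
proof -
  define n where "n = card V"
  define v where "v = from_nat_into V"
  have bij: "bij_betw v {..<n} V"
    unfolding v_def n_def by (rule bij_betw_from_nat_into_finite[OF fin])
  have vV: "v i \<in> V" if "i < n" for i
    using bij that by (auto simp: bij_betw_def)
  have v_eq: "v i = v j \<longleftrightarrow> i = j" if "i < n" "j < n" for i j
    using bij that by (auto simp: bij_betw_def inj_on_def)
  have sumV: "(\<Sum>x\<in>V. f x) = (\<Sum>a<n. f (v a))" for f :: "'a \<Rightarrow> complex"
    using sum.reindex_bij_betw[OF bij, of f] by simp
  have "\<exists>(u :: nat \<Rightarrow> 'a \<Rightarrow> complex) (lam :: nat \<Rightarrow> real).
    (\<forall>i<n. \<forall>j<n. (\<Sum>x\<in>V. cnj (u i x) * u j x) = of_bool (i = j)) \<and>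
    (\<forall>i<n. \<forall>x\<in>V. (\<Sum>y\<in>V. A x y * u i y) = of_real (lam i) * u i x)"
    by (rule orthonormal_eigenvectors[OF fin herm]) (auto simp: n_def)
  then obtain u lam
    where ul: "\<forall>i<n. \<forall>j<n. (\<Sum>x\<in>V. cnj (u i x) * u j x) = of_bool (i = j)"
      "\<forall>i<n. \<forall>x\<in>V. (\<Sum>y\<in>V. A x y * u i y) = of_real (lam i) * u i x"
    by (elim exE conjE) (rule that)
  define U where "U = mat n n (\<lambda>(a, i). u i (v a))"
  define U' where "U' = mat n n (\<lambda>(i, a). cnj (u i (v a)))"
  define D where "D = mat n n (\<lambda>(i, j). if i = j then complex_of_real (lam i) else 0)"
  define C where "C = indexed_mat V A"
  have carr: "U \<in> carrier_mat n n" "U' \<in> carrier_mat n n" "D \<in> carrier_mat n n" "C \<in> carrier_mat n n"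
    by (auto simp: U_def U'_def D_def C_def n_def)
  have U'U: "U' * U = 1\<^sub>m n"
  proof (rule eq_matI)
    fix i j assume "i < dim_row (1\<^sub>m n)" "j < dim_col (1\<^sub>m n)"
    then have ij: "i < n" "j < n" by auto
    then have "(U' * U) $$ (i, j) = (\<Sum>a<n. cnj (u i (v a)) * u j (v a))"
      by (simp add: U_def U'_def scalar_prod_def lessThan_atLeast0)
    also have "\<dots> = (\<Sum>x\<in>V. cnj (u i x) * u j x)" by (simp only: sumV)
    also have "\<dots> = 1\<^sub>m n $$ (i, j)" using ul(1) ij by simp
    finally show "(U' * U) $$ (i, j) = 1\<^sub>m n $$ (i, j)" .
  qed (use carr in auto)
  \<comment> \<open>For square matrices a left inverse is a right inverse, which turns
    orthonormality into completeness.\<close>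
  have UU': "U * U' = 1\<^sub>m n"
    using mat_mult_left_right_inverse[OF carr(2,1) U'U] .
  have compl: "(\<Sum>i<n. u i x * cnj (u i y)) = of_bool (x = y)" if "x \<in> V" "y \<in> V" for x y
  proof -
    obtain a b where ab: "a < n" "b < n" "x = v a" "y = v b"
      using bij \<open>x \<in> V\<close> \<open>y \<in> V\<close> unfolding bij_betw_def by (metis imageE lessThan_iff)
    have "(\<Sum>i<n. u i x * cnj (u i y)) = (U * U') $$ (a, b)"
      using ab by (simp add: U_def U'_def scalar_prod_def lessThan_atLeast0)
    then show ?thesis using ab by (simp add: UU' v_eq)
  qed
  have sb: "spectral_basis V A u lam"
  proof
    show "finite V" by (rule fin)
    show "A y x = cnj (A x y)" if "x \<in> V" "y \<in> V" for x y using that by (rule herm)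
  qed (use ul compl in \<open>simp_all add: n_def\<close>)
  have CU: "C * U = U * D"
  proof (rule eq_matI)
    fix a i assume "a < dim_row (U * D)" "i < dim_col (U * D)"
    then have ai: "a < n" "i < n" using carr by auto
    then have "(C * U) $$ (a, i) = (\<Sum>b<n. A (v a) (v b) * u i (v b))"
      by (simp add: C_def U_def indexed_mat_def scalar_prod_def lessThan_atLeast0 n_def v_def)
    also have "\<dots> = (\<Sum>y\<in>V. A (v a) y * u i y)" by (simp only: sumV)
    also have "\<dots> = of_real (lam i) * u i (v a)" using ul(2) ai vV by blast
    also have "\<dots> = (\<Sum>j<n. u j (v a) * (if j = i then complex_of_real (lam j) else 0))"
      using ai by (simp add: if_distrib[of "(*) _"] mult.commute cong: if_cong)
    also have "\<dots> = (U * D) $$ (a, i)"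
      using ai by (simp add: D_def U_def scalar_prod_def lessThan_atLeast0)
    finally show "(C * U) $$ (a, i) = (U * D) $$ (a, i)" .
  qed (use carr in auto)
  have "C = C * (U * U')" using carr by (simp add: UU')
  also have "\<dots> = C * U * U'" using carr by (simp add: assoc_mult_mat[of _ n n _ n _ n])
  finally have "C = U * D * U'" by (simp only: CU)
  then have "similar_mat C D"
    using carr U'U UU' by (intro similar_matI[of C D U U' n]) auto
  moreover have "upper_triangular D"
    by (rule upper_triangularI) (simp add: D_def)
  ultimately have "char_poly C = (\<Prod>a\<leftarrow>diag_mat D. [:- a, 1:])"
    using char_poly_similar char_poly_upper_triangular[OF carr(3)] by metis
  moreover have "diag_mat D = map (\<lambda>i. complex_of_real (lam i)) [0..<n]"
    by (auto simp: diag_mat_def D_def)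
  ultimately have "eigenvalue_mset C = mset (map (\<lambda>i. complex_of_real (lam i)) [0..<n])"
    by (simp only: eigenvalue_mset_def proots_linear_factors)
  then have "eigenvalue_mset C = image_mset (\<lambda>i. complex_of_real (lam i)) (mset_set {..<n})"
    by (simp add: lessThan_atLeast0 mset_upt)
  then show thesis using sb that by (simp add: C_def n_def)
qed

section \<open>Spectral projections\<close>

text \<open>The matrix power without an enumeration of \<open>V\<close>; for an adjacency matrix it
  counts walks of length \<open>l\<close>. Multiplying on the right matches the recursion of
  \<open>^\<^sub>m\<close>.\<close>

primrec kernel_power :: "'a set \<Rightarrow> ('a \<Rightarrow> 'a \<Rightarrow> complex) \<Rightarrow> nat \<Rightarrow> 'a \<Rightarrow> 'a \<Rightarrow> complex" where
  "kernel_power V A 0 x y = of_bool (x = y)"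
| "kernel_power V A (Suc l) x y = (\<Sum>z\<in>V. kernel_power V A l x z * A z y)"

lemma kernel_power_1:
  "finite V \<Longrightarrow> x \<in> V \<Longrightarrow> kernel_power V A (Suc 0) x y = A x y"
  by (simp add: of_bool_def if_distrib[of "\<lambda>c. c * _"] cong: if_cong)

lemma kernel_power_2:
  "finite V \<Longrightarrow> x \<in> V \<Longrightarrow> kernel_power V A 2 x y = (\<Sum>z\<in>V. A x z * A z y)"
  by (simp only: numeral_2_eq_2 kernel_power.simps(2)[of V A "Suc 0"] kernel_power_1)

text \<open>The Lagrange basis polynomial for the node \<open>c\<close>. It serves to isolate one
  eigenvalue, both in a matrix and in a list of power sums.\<close>

lemma interpolating_polynomial:
  fixes S :: "real set"
  assumes "finite S"
  shows "\<exists>p. \<forall>x\<in>S. poly p x = of_bool (x = c)"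
proof (intro exI ballI)
  define p where "p = (\<Prod>d\<in>S - {c}. Polynomial.smult (1 / (c - d)) [:- d, 1:])"
  fix x assume x: "x \<in> S"
  have "poly p x = of_bool (x = c)"
  proof (cases "x = c")
    case True
    have "(\<Prod>d\<in>S - {c}. poly (Polynomial.smult (1 / (c - d)) [:- d, 1:]) c) = 1"
      by (intro prod.neutral) (auto simp: diff_divide_distrib[symmetric])
    then show ?thesis using True by (simp add: p_def poly_prod)
  next
    case False
    then have "(\<Prod>d\<in>S - {c}. poly (Polynomial.smult (1 / (c - d)) [:- d, 1:]) x) = 0"
      using x assms by (intro prod_zero) (auto intro!: bexI[of _ x])
    then show ?thesis using False by (simp add: p_def poly_prod)
  qed
  then show "poly (\<Prod>d\<in>S - {c}. Polynomial.smult (1 / (c - d)) [:- d, 1:]) x = of_bool (x = c)"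
    by (simp only: p_def)
qed

section \<open>Spectral projections as polynomials in the matrix\<close>

context spectral_basis
begin

definition eigen_mult :: "real \<Rightarrow> nat" where
  "eigen_mult c = card {i \<in> {..<card V}. lam i = c}"

text \<open>The orthogonal projection onto the eigenspace of \<open>c\<close>, which is zero if
  \<open>c\<close> is not an eigenvalue.\<close>

definition eproj :: "real \<Rightarrow> 'a \<Rightarrow> 'a \<Rightarrow> complex" where
  "eproj c x y = (\<Sum>i\<in>{i \<in> {..<card V}. lam i = c}. u i x * cnj (u i y))"

lemma kernel_power_expansion:
  assumes "x \<in> V" "y \<in> V"
  shows "kernel_power V A l x y = (\<Sum>i<card V. of_real (lam i ^ l) * (u i x * cnj (u i y)))"
  using assms(2)
proof (induction l arbitrary: y)
  case 0
  then show ?case using complete[OF assms(1)] by simp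
next
  case (Suc l)
  \<comment> \<open>Conjugating \<open>eigen\<close> yields the relation for multiplication from the
    left; the eigenvalue is real and stays the same.\<close>
  have eig': "(\<Sum>z\<in>V. cnj (u i z) * A z y) = of_real (lam i) * cnj (u i y)" if "i < card V" for i
  proof -
    have "(\<Sum>z\<in>V. cnj (u i z) * A z y) = cnj (\<Sum>z\<in>V. A y z * u i z)"
      unfolding cnj_sum
    proof (rule sum.cong[OF refl])
      fix z assume "z \<in> V"
      then show "cnj (u i z) * A z y = cnj (A y z * u i z)"
        using hermitian[of y z] Suc.prems by simp
    qed
    then show ?thesis using eigen[OF that Suc.prems] by simp
  qed
  have "kernel_power V A (Suc l) x y
      = (\<Sum>z\<in>V. \<Sum>i<card V. of_real (lam i ^ l) * (u i x * (cnj (u i z) * A z y)))"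
    unfolding kernel_power.simps
    by (intro sum.cong refl) (simp only: Suc.IH sum_distrib_right mult.assoc)
  also have "\<dots> = (\<Sum>i<card V. of_real (lam i ^ l) * (u i x * (\<Sum>z\<in>V. cnj (u i z) * A z y)))"
    unfolding sum_distrib_left by (rule sum.swap)
  also have "\<dots> = (\<Sum>i<card V. of_real (lam i ^ Suc l) * (u i x * cnj (u i y)))"
  proof (intro sum.cong refl)
    fix i assume "i \<in> {..<card V}"
    then show "of_real (lam i ^ l) * (u i x * (\<Sum>z\<in>V. cnj (u i z) * A z y))
        = of_real (lam i ^ Suc l) * (u i x * cnj (u i y))"
      using eig'[of i] by simp
  qed
  finally show ?case .
qed

lemma trace_rank_one: "i < card V \<Longrightarrow> (\<Sum>x\<in>V. u i x * cnj (u i x)) = 1"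
  using orthonormal[of i i] by (simp add: mult.commute)

lemma trace_kernel_power:
  "(\<Sum>x\<in>V. kernel_power V A l x x) = (\<Sum>i<card V. of_real (lam i ^ l))"
proof -
  have "(\<Sum>x\<in>V. kernel_power V A l x x)
      = (\<Sum>x\<in>V. \<Sum>i<card V. of_real (lam i ^ l) * (u i x * cnj (u i x)))"
    by (intro sum.cong refl) (simp only: kernel_power_expansion)
  also have "\<dots> = (\<Sum>i<card V. of_real (lam i ^ l) * (\<Sum>x\<in>V. u i x * cnj (u i x)))"
    unfolding sum_distrib_left by (rule sum.swap)
  also have "\<dots> = (\<Sum>i<card V. of_real (lam i ^ l))"
    by (intro sum.cong refl) (simp add: trace_rank_one)
  finally show ?thesis .
qed

lemma eproj_sum:
  assumes "x \<in> V" "y \<in> V"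
  shows "(\<Sum>c\<in>lam ` {..<card V}. of_real (c ^ l) * eproj c x y) = kernel_power V A l x y"
proof -
  have "(\<Sum>c\<in>lam ` {..<card V}. of_real (c ^ l) * eproj c x y)
      = (\<Sum>c\<in>lam ` {..<card V}. \<Sum>i\<in>{i \<in> {..<card V}. lam i = c}.
          of_real (lam i ^ l) * (u i x * cnj (u i y)))"
    unfolding eproj_def sum_distrib_left by (intro sum.cong refl) auto
  also have "\<dots> = (\<Sum>i<card V. of_real (lam i ^ l) * (u i x * cnj (u i y)))"
    by (rule sum.group) auto
  finally show ?thesis using kernel_power_expansion[OF assms] by simp
qed

lemma eproj_sum_id:
  assumes "x \<in> V" "y \<in> V"
  shows "(\<Sum>c\<in>lam ` {..<card V}. eproj c x y) = of_bool (x = y)"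
  using eproj_sum[OF assms, of 0] by simp

lemma eproj_sum_mult:
  assumes "x \<in> V" "y \<in> V"
  shows "(\<Sum>c\<in>lam ` {..<card V}. of_real c * eproj c x y) = A x y"
  using eproj_sum[OF assms, of 1] kernel_power_1[OF fin assms(1), of A y] by simp

text \<open>A polynomial that is 1 at \<open>c\<close> and 0 at the other eigenvalues maps
  \<open>A\<close> to its projection for \<open>c\<close>. Its coefficients do not depend on
  \<open>x\<close> and \<open>y\<close>, so constancy of entries passes from the powers to the
  projection.\<close>

lemma eproj_polynomial:
  "\<exists>(a :: nat \<Rightarrow> complex) N. \<forall>x\<in>V. \<forall>y\<in>V. eproj c x y = (\<Sum>l\<le>N. a l * kernel_power V A l x y)"
proof -
  obtain p :: "real poly" where p': "\<And>x. x \<in> lam ` {..<card V} \<Longrightarrow> poly p x = of_bool (x = c)"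
    using interpolating_polynomial[of "lam ` {..<card V}" c] by auto
  have p: "poly p (lam i) = of_bool (lam i = c)" if "i < card V" for i
    using that by (intro p') simp
  have "eproj c x y = (\<Sum>l\<le>degree p. of_real (coeff p l) * kernel_power V A l x y)"
    if xy: "x \<in> V" "y \<in> V" for x y
  proof -
    have "(\<Sum>l\<le>degree p. of_real (coeff p l) * kernel_power V A l x y)
        = (\<Sum>l\<le>degree p. \<Sum>i<card V. of_real (coeff p l * lam i ^ l) * (u i x * cnj (u i y)))"
      by (simp only: kernel_power_expansion[OF xy] sum_distrib_left of_real_mult mult.assoc)
    also have "\<dots> = (\<Sum>i<card V. of_real (\<Sum>l\<le>degree p. coeff p l * lam i ^ l) * (u i x * cnj (u i y)))"
      by (subst sum.swap) (simp only: of_real_sum sum_distrib_right)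
    also have "\<dots> = (\<Sum>i<card V. of_bool (lam i = c) * (u i x * cnj (u i y)))"
      by (intro sum.cong refl) (simp add: poly_altdef[symmetric] p)
    also have "\<dots> = eproj c x y"
      unfolding eproj_def by (rule sum.mono_neutral_cong_right) auto
    finally show ?thesis by simp
  qed
  then show ?thesis by (intro exI[of _ "\<lambda>l. of_real (coeff p l)"] exI[of _ "degree p"]) blast
qed

lemma trace_eproj: "(\<Sum>x\<in>V. eproj c x x) = of_nat (eigen_mult c)"
proof -
  have "(\<Sum>x\<in>V. eproj c x x)
      = (\<Sum>i\<in>{i \<in> {..<card V}. lam i = c}. \<Sum>x\<in>V. u i x * cnj (u i x))"
    unfolding eproj_def by (rule sum.swap)
  also have "\<dots> = (\<Sum>i\<in>{i \<in> {..<card V}. lam i = c}. 1)"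
    by (intro sum.cong refl) (simp add: trace_rank_one)
  finally show ?thesis by (simp add: eigen_mult_def)
qed

text \<open>\<open>A\<close> acts on the image of the projection as multiplication by
  \<open>c\<close>.\<close>

lemma trace_mult_eproj:
  "(\<Sum>x\<in>V. \<Sum>y\<in>V. A x y * eproj c y x) = of_real c * of_nat (eigen_mult c)"
proof -
  have "(\<Sum>x\<in>V. \<Sum>y\<in>V. A x y * eproj c y x) = (\<Sum>x\<in>V. of_real c * eproj c x x)"
  proof (rule sum.cong[OF refl])
    fix x assume x: "x \<in> V"
    have "(\<Sum>y\<in>V. A x y * eproj c y x)
        = (\<Sum>y\<in>V. \<Sum>i\<in>{i \<in> {..<card V}. lam i = c}. A x y * u i y * cnj (u i x))"
      by (simp only: eproj_def sum_distrib_left mult.assoc)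
    also have "\<dots> = (\<Sum>i\<in>{i \<in> {..<card V}. lam i = c}. (\<Sum>y\<in>V. A x y * u i y) * cnj (u i x))"
      by (subst sum.swap) (simp only: sum_distrib_right)
    also have "\<dots> = (\<Sum>i\<in>{i \<in> {..<card V}. lam i = c}. of_real c * (u i x * cnj (u i x)))"
      by (intro sum.cong refl) (simp add: eigen x mult.assoc)
    finally show "(\<Sum>y\<in>V. A x y * eproj c y x) = of_real c * eproj c x x"
      by (simp only: eproj_def sum_distrib_left)
  qed
  then show ?thesis by (simp only: sum_distrib_left[symmetric] trace_eproj)
qed

text \<open>The diagonal is constant because that of every power is, and the trace fixes its
  value.\<close>

lemma eproj_diagonal:
  assumes "\<And>l. \<exists>a. \<forall>x\<in>V. kernel_power V A l x x = a" and x: "x \<in> V"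
  shows "eproj c x x = of_nat (eigen_mult c) / of_nat (card V)"
proof -
  obtain q :: "nat \<Rightarrow> complex" and N
    where q: "\<forall>x\<in>V. \<forall>y\<in>V. eproj c x y = (\<Sum>l\<le>N. q l * kernel_power V A l x y)"
    using eproj_polynomial by blast
  obtain a where a: "\<And>l. \<forall>x\<in>V. kernel_power V A l x x = a l"
    using assms(1) by metis
  have const: "eproj c y y = eproj c x x" if "y \<in> V" for y
  proof -
    have "\<forall>z\<in>V. eproj c z z = (\<Sum>l\<le>N. q l * a l)" using q a by simp
    then show ?thesis using that x by simp
  qed
  have "of_nat (eigen_mult c) = of_nat (card V) * eproj c x x"
    unfolding trace_eproj[symmetric] by (simp add: const)
  moreover have "card V \<noteq> 0" using x fin by auto
  ultimately show ?thesis by simp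
qed

text \<open>The entries on arcs are constant because those of every power are. The trace of
  \<open>A\<close> times the projection adds them up over all arcs, which fixes their value.\<close>

lemma eproj_adjacent:
  assumes "\<And>l. \<exists>b. \<forall>x\<in>V. \<forall>y\<in>V. A x y = 1 \<longrightarrow> kernel_power V A l x y = b"
    and A01: "\<And>x y. x \<in> V \<Longrightarrow> y \<in> V \<Longrightarrow> A x y \<in> {0, 1}"
    and x: "x \<in> V" and y: "y \<in> V" and xy: "A x y = 1"
  shows "eproj c x y = of_real c * of_nat (eigen_mult c) / (\<Sum>x\<in>V. \<Sum>y\<in>V. A x y)"
proof -
  obtain q :: "nat \<Rightarrow> complex" and N
    where q: "\<forall>x\<in>V. \<forall>y\<in>V. eproj c x y = (\<Sum>l\<le>N. q l * kernel_power V A l x y)"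
    using eproj_polynomial by blast
  obtain b where b: "\<And>l. \<forall>x\<in>V. \<forall>y\<in>V. A x y = 1 \<longrightarrow> kernel_power V A l x y = b l"
    using assms(1) by metis
  have const: "eproj c z w = eproj c x y" if "z \<in> V" "w \<in> V" "A z w = 1" for z w
  proof -
    have "\<forall>z\<in>V. \<forall>w\<in>V. A z w = 1 \<longrightarrow> eproj c z w = (\<Sum>l\<le>N. q l * b l)" using q b by simp
    then show ?thesis using that x y xy by simp
  qed
  have "of_real c * of_nat (eigen_mult c) = (\<Sum>z\<in>V. \<Sum>w\<in>V. A z w * eproj c x y)"
    unfolding trace_mult_eproj[symmetric]
  proof (intro sum.cong refl)
    fix z w assume zw: "z \<in> V" "w \<in> V"
    have "A w z = 1" if "A z w = 1"
      using hermitian[OF zw] that by simp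
    then show "A z w * eproj c w z = A z w * eproj c x y"
      using A01[OF zw] const[OF zw(2,1)] by auto
  qed
  also have "\<dots> = (\<Sum>x\<in>V. \<Sum>y\<in>V. A x y) * eproj c x y"
    by (simp only: sum_distrib_right)
  finally have eq: "of_real c * of_nat (eigen_mult c) = (\<Sum>x\<in>V. \<Sum>y\<in>V. A x y) * eproj c x y" .
  \<comment> \<open>The arc from \<open>x\<close> to \<open>y\<close> makes the number of arcs
    non-zero, so it may be divided by.\<close>
  have "(\<Sum>x\<in>V. \<Sum>y\<in>V. Re (A x y)) > 0"
  proof (rule sum_pos2[OF fin x])
    have nonneg: "0 \<le> Re (A z w)" if "z \<in> V" "w \<in> V" for z w
      using A01[OF that] by auto
    show "0 < (\<Sum>y\<in>V. Re (A x y))"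
      using nonneg x xy by (intro sum_pos2[OF fin y]) auto
    show "0 \<le> (\<Sum>y\<in>V. Re (A z y))" if "z \<in> V" for z
      using nonneg that by (intro sum_nonneg) auto
  qed
  then have "Re (\<Sum>x\<in>V. \<Sum>y\<in>V. A x y) > 0" by simp
  then have "(\<Sum>x\<in>V. \<Sum>y\<in>V. A x y) \<noteq> 0" by (metis less_irrefl zero_complex.sel(1))
  then show ?thesis using eq by simp
qed

end

text \<open>The Dirichlet form, the sum of \<open>A x y\<close> times the squared modulus of
  \<open>f x - f y\<close>, expands into four terms, each equal up to sign to \<open>k\<close> times
  the squared norm of \<open>f\<close>. They cancel, and every non-negative summand is zero.\<close>

lemma harmonic_adjacent_equal:
  fixes A :: "'a \<Rightarrow> 'a \<Rightarrow> complex" and k :: complex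
  assumes fin: "finite V"
    and A01: "\<And>x y. x \<in> V \<Longrightarrow> y \<in> V \<Longrightarrow> A x y \<in> {0, 1}"
    and sym: "\<And>x y. x \<in> V \<Longrightarrow> y \<in> V \<Longrightarrow> A y x = A x y"
    and reg: "\<And>x. x \<in> V \<Longrightarrow> (\<Sum>y\<in>V. A x y) = k"
    and eig: "\<And>x. x \<in> V \<Longrightarrow> (\<Sum>y\<in>V. A x y * f y) = k * f x"
    and xy: "x \<in> V" "y \<in> V" "A x y = 1"
  shows "f x = f y"
proof -
  have p1: "(\<Sum>x\<in>V. \<Sum>y\<in>V. A x y * (f x * cnj (f x))) = (\<Sum>x\<in>V. k * (f x * cnj (f x)))"
    by (intro sum.cong refl) (simp only: sum_distrib_right[symmetric] reg)
  have p2: "(\<Sum>x\<in>V. \<Sum>y\<in>V. A x y * (f y * cnj (f y))) = (\<Sum>x\<in>V. k * (f x * cnj (f x)))"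
  proof (subst sum.swap, intro sum.cong refl)
    fix x assume x: "x \<in> V"
    have "(\<Sum>y\<in>V. A y x * (f x * cnj (f x))) = (\<Sum>y\<in>V. A x y) * (f x * cnj (f x))"
      unfolding sum_distrib_right using sym[OF x] by (intro sum.cong refl) simp
    then show "(\<Sum>y\<in>V. A y x * (f x * cnj (f x))) = k * (f x * cnj (f x))"
      using reg[OF x] by simp
  qed
  have p3: "(\<Sum>x\<in>V. \<Sum>y\<in>V. A x y * (f y * cnj (f x))) = (\<Sum>x\<in>V. k * (f x * cnj (f x)))"
  proof (intro sum.cong refl)
    fix x assume "x \<in> V"
    then show "(\<Sum>y\<in>V. A x y * (f y * cnj (f x))) = k * (f x * cnj (f x))"
      using eig by (simp only: mult.assoc[symmetric] sum_distrib_right[symmetric])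
  qed
  have p4: "(\<Sum>x\<in>V. \<Sum>y\<in>V. A x y * (f x * cnj (f y))) = (\<Sum>x\<in>V. k * (f x * cnj (f x)))"
  proof (subst sum.swap, intro sum.cong refl)
    fix x assume x: "x \<in> V"
    have "(\<Sum>y\<in>V. A y x * (f y * cnj (f x))) = (\<Sum>y\<in>V. A x y * f y) * cnj (f x)"
      unfolding sum_distrib_right using sym[OF x] by (intro sum.cong refl) simp
    then show "(\<Sum>y\<in>V. A y x * (f y * cnj (f x))) = k * (f x * cnj (f x))"
      using eig[OF x] by simp
  qed
  have "(\<Sum>x\<in>V. \<Sum>y\<in>V. A x y * ((f x - f y) * cnj (f x - f y)))
     = (\<Sum>x\<in>V. \<Sum>y\<in>V. A x y * (f x * cnj (f x))) + (\<Sum>x\<in>V. \<Sum>y\<in>V. A x y * (f y * cnj (f y)))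
     - (\<Sum>x\<in>V. \<Sum>y\<in>V. A x y * (f y * cnj (f x))) - (\<Sum>x\<in>V. \<Sum>y\<in>V. A x y * (f x * cnj (f y)))"
    unfolding sum.distrib[symmetric] sum_subtractf[symmetric]
    by (intro sum.cong refl) (simp add: algebra_simps)
  then have "(\<Sum>x\<in>V. \<Sum>y\<in>V. A x y * ((f x - f y) * cnj (f x - f y))) = 0"
    by (simp only: p1 p2 p3 p4) simp
  moreover have sq: "A x y * ((f x - f y) * cnj (f x - f y)) = of_real (Re (A x y) * (cmod (f x - f y))\<^sup>2)"
    if "x \<in> V" "y \<in> V" for x y
    using A01[OF that] complex_norm_square[of "f x - f y"] by auto
  moreover have "(\<Sum>x\<in>V. \<Sum>y\<in>V. A x y * ((f x - f y) * cnj (f x - f y)))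
      = of_real (\<Sum>x\<in>V. \<Sum>y\<in>V. Re (A x y) * (cmod (f x - f y))\<^sup>2)"
    unfolding of_real_sum by (intro sum.cong refl sq)
  ultimately have "(\<Sum>x\<in>V. \<Sum>y\<in>V. Re (A x y) * (cmod (f x - f y))\<^sup>2) = 0"
    by (simp only: of_real_eq_0_iff)
  moreover have nonneg: "0 \<le> Re (A z w) * (cmod (f z - f w))\<^sup>2" if "z \<in> V" "w \<in> V" for z w
    using A01[OF that] by auto
  ultimately have "Re (A x y) * (cmod (f x - f y))\<^sup>2 = 0"
    using xy(1,2) fin by (subst (asm) sum_nonneg_eq_0_iff) (auto simp: sum_nonneg sum_nonneg_eq_0_iff)
  then show ?thesis using xy(3) by simp
qed

section \<open>From cospectrality to a positive semidefinite matrix\<close>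

lemma psd_on_hermitian: "psd_on I M \<Longrightarrow> i \<in> I \<Longrightarrow> j \<in> I \<Longrightarrow> M j i = cnj (M i j)"
  unfolding psd_on_def by blast

lemma psd_on_nonneg: "psd_on I M \<Longrightarrow> 0 \<le> Re (\<Sum>i\<in>I. \<Sum>j\<in>I. cnj (x i) * M i j * x j)"
  unfolding psd_on_def by blast

lemma psd_on_rank_one:
  fixes I :: "'i set"
  shows "psd_on I (\<lambda>p q. f p * cnj (f q))"
  unfolding psd_on_def
proof (intro conjI ballI allI)
  fix x :: "'i \<Rightarrow> complex"
  have "(\<Sum>i\<in>I. \<Sum>j\<in>I. cnj (x i) * (f i * cnj (f j)) * x j)
      = (\<Sum>i\<in>I. cnj (x i) * f i) * cnj (\<Sum>i\<in>I. cnj (x i) * f i)"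
    unfolding cnj_sum sum_product by (intro sum.cong refl) simp
  then show "0 \<le> Re (\<Sum>i\<in>I. \<Sum>j\<in>I. cnj (x i) * (f i * cnj (f j)) * x j)"
    by (simp only: complex_mult_cnj Re_complex_of_real) simp
qed simp

lemma psd_on_sum:
  fixes I :: "'i set"
  assumes "\<And>t. t \<in> T \<Longrightarrow> psd_on I (M t)"
  shows "psd_on I (\<lambda>p q. \<Sum>t\<in>T. M t p q)"
  unfolding psd_on_def
proof (intro conjI ballI allI)
  fix i j assume "i \<in> I" "j \<in> I"
  then show "(\<Sum>t\<in>T. M t j i) = cnj (\<Sum>t\<in>T. M t i j)"
    unfolding cnj_sum by (intro sum.cong refl psd_on_hermitian[OF assms])
next
  fix x :: "'i \<Rightarrow> complex"
  have "(\<Sum>i\<in>I. \<Sum>j\<in>I. cnj (x i) * (\<Sum>t\<in>T. M t i j) * x j)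
      = (\<Sum>i\<in>I. \<Sum>t\<in>T. \<Sum>j\<in>I. cnj (x i) * M t i j * x j)"
    by (intro sum.cong refl) (subst sum.swap, simp only: sum_distrib_left sum_distrib_right)
  also have "\<dots> = (\<Sum>t\<in>T. \<Sum>i\<in>I. \<Sum>j\<in>I. cnj (x i) * M t i j * x j)"
    by (rule sum.swap)
  finally show "0 \<le> Re (\<Sum>i\<in>I. \<Sum>j\<in>I. cnj (x i) * (\<Sum>t\<in>T. M t i j) * x j)"
    using psd_on_nonneg[OF assms] by (simp add: sum_nonneg)
qed

lemma psd_on_scale:
  fixes I :: "'i set"
  assumes "psd_on I M" "0 \<le> r"
  shows "psd_on I (\<lambda>p q. of_real r * M p q)"
  unfolding psd_on_def
proof (intro conjI ballI allI)
  fix i j assume "i \<in> I" "j \<in> I"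
  from psd_on_hermitian[OF assms(1) this]
  show "of_real r * M j i = cnj (of_real r * M i j)"
    by simp
next
  fix x :: "'i \<Rightarrow> complex"
  have "(\<Sum>i\<in>I. \<Sum>j\<in>I. cnj (x i) * (of_real r * M i j) * x j)
      = of_real r * (\<Sum>i\<in>I. \<Sum>j\<in>I. cnj (x i) * M i j * x j)"
    unfolding sum_distrib_left by (intro sum.cong refl) (simp only: mult_ac)
  then show "0 \<le> Re (\<Sum>i\<in>I. \<Sum>j\<in>I. cnj (x i) * (of_real r * M i j) * x j)"
    using psd_on_nonneg[OF assms(1), of x] assms(2) by simp
qed

section \<open>The valency as a simple eigenvalue of a connected regular graph\<close>

context spectral_basis
begin

lemma eigen_mult_pos: "c \<in> lam ` {..<card V} \<Longrightarrow> eigen_mult c > 0"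
  by (auto simp: eigen_mult_def card_gt_0_iff)

text \<open>Connectedness enters as the statement that a function constant along arcs is constant.
  Complex values allow it to be applied directly to eigenvectors.\<close>

context
  fixes k :: real
  assumes nonempty: "V \<noteq> {}"
    and A01: "\<And>x y. x \<in> V \<Longrightarrow> y \<in> V \<Longrightarrow> A x y \<in> {0, 1}"
    and regular: "\<And>x. x \<in> V \<Longrightarrow> (\<Sum>y\<in>V. A x y) = of_real k"
    and connected: "\<And>(f :: 'a \<Rightarrow> complex) x y. (\<And>x y. x \<in> V \<Longrightarrow> y \<in> V \<Longrightarrow> A x y = 1 \<Longrightarrow> f x = f y) \<Longrightarrow>
      x \<in> V \<Longrightarrow> y \<in> V \<Longrightarrow> f x = f y"
begin

lemma symmetric: "x \<in> V \<Longrightarrow> y \<in> V \<Longrightarrow> A y x = A x y"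
  using hermitian[of x y] A01[of x y] by auto

text \<open>The all-ones vector is an eigenvector for \<open>k\<close>, hence orthogonal to the
  eigenvectors for other eigenvalues.\<close>

lemma eigenvector_sum_zero:
  assumes i: "i < card V" "lam i \<noteq> k"
  shows "(\<Sum>x\<in>V. u i x) = 0"
proof -
  have "of_real (lam i) * (\<Sum>x\<in>V. u i x) = (\<Sum>x\<in>V. \<Sum>y\<in>V. A x y * u i y)"
    unfolding sum_distrib_left by (intro sum.cong refl) (simp add: eigen i)
  also have "\<dots> = (\<Sum>y\<in>V. (\<Sum>x\<in>V. A x y) * u i y)"
    by (subst sum.swap) (simp only: sum_distrib_right)
  also have "\<dots> = (\<Sum>y\<in>V. of_real k * u i y)"
  proof (intro sum.cong refl)
    fix y assume y: "y \<in> V"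
    have "(\<Sum>x\<in>V. A x y) = (\<Sum>x\<in>V. A y x)"
      using symmetric[OF y] by (intro sum.cong refl) simp
    then show "(\<Sum>x\<in>V. A x y) * u i y = of_real k * u i y" using regular[OF y] by simp
  qed
  finally have "of_real (lam i) * (\<Sum>x\<in>V. u i x) = of_real k * (\<Sum>x\<in>V. u i x)"
    by (simp only: sum_distrib_left)
  then show ?thesis using i(2) by simp
qed

lemma eproj_row_sum_zero:
  assumes "c \<noteq> k"
  shows "(\<Sum>y\<in>V. eproj c x y) = 0"
proof -
  have "(\<Sum>y\<in>V. eproj c x y)
      = (\<Sum>i\<in>{i \<in> {..<card V}. lam i = c}. u i x * cnj (\<Sum>y\<in>V. u i y))"
    unfolding eproj_def cnj_sum sum_distrib_left by (rule sum.swap)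
  also have "\<dots> = 0"
    using assms eigenvector_sum_zero by (intro sum.neutral) auto
  finally show ?thesis .
qed

text \<open>Eigenvectors for \<open>k\<close> agree on adjacent vertices by
  \<open>harmonic_adjacent_equal\<close>, so they are constant by connectedness.\<close>

lemma eproj_valency_const:
  assumes "x \<in> V" "y \<in> V" "x' \<in> V" "y' \<in> V"
  shows "eproj k x y = eproj k x' y'"
proof -
  have *: "u i x = u i y" if i: "i < card V" "lam i = k" and "x \<in> V" "y \<in> V" for i x y
  proof (rule connected)
    show "u i x = u i y" if "x \<in> V" "y \<in> V" "A x y = 1" for x y
      by (rule harmonic_adjacent_equal[OF fin A01 symmetric regular _ that])
        (use eigen i in auto)
  qed fact+
  show ?thesis unfolding eproj_def
  proof (intro sum.cong refl)
    fix i assume "i \<in> {i \<in> {..<card V}. lam i = k}"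
    then show "u i x * cnj (u i y) = u i x' * cnj (u i y')"
      using *[of i x x'] *[of i y y'] assms by simp
  qed
qed

text \<open>The projections sum to the identity, whose row sums are 1, and only the projection for
  \<open>k\<close> can have non-zero row sums. If \<open>k\<close> were not an eigenvalue, this
  would read 1 = 0.\<close>

lemma valency_eigenvalue: "k \<in> lam ` {..<card V}"
  and eproj_valency_row_sum: "x \<in> V \<Longrightarrow> (\<Sum>y\<in>V. eproj k x y) = 1"
proof -
  have *: "k \<in> lam ` {..<card V} \<and> (\<Sum>y\<in>V. eproj k x y) = 1" if x: "x \<in> V" for x
  proof -
    have "1 = (\<Sum>y\<in>V. of_bool (x = y) :: complex)"
      using x fin by (simp add: of_bool_def)
    also have "\<dots> = (\<Sum>y\<in>V. \<Sum>c\<in>lam ` {..<card V}. eproj c x y)"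
      using x by (intro sum.cong refl) (simp add: eproj_sum_id)
    also have "\<dots> = (\<Sum>c\<in>lam ` {..<card V}. \<Sum>y\<in>V. eproj c x y)"
      by (rule sum.swap)
    also have "\<dots> = (\<Sum>c\<in>lam ` {..<card V}. if c = k then (\<Sum>y\<in>V. eproj k x y) else 0)"
      by (intro sum.cong refl) (auto simp: eproj_row_sum_zero)
    also have "\<dots> = (if k \<in> lam ` {..<card V} then (\<Sum>y\<in>V. eproj k x y) else 0)"
      by (rule sum.delta) simp
    finally show ?thesis by (metis zero_neq_one)
  qed
  show "k \<in> lam ` {..<card V}" using * nonempty by blast
  show "(\<Sum>y\<in>V. eproj k x y) = 1" if "x \<in> V" using * that by blast
qed

lemma eproj_row_sum: "x \<in> V \<Longrightarrow> (\<Sum>y\<in>V. eproj c x y) = of_bool (c = k)"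
  by (simp add: eproj_row_sum_zero eproj_valency_row_sum)

lemma eproj_valency:
  assumes "x \<in> V" "y \<in> V"
  shows "eproj k x y = 1 / of_nat (card V)"
proof -
  have "1 = (\<Sum>z\<in>V. eproj k x y)"
    unfolding eproj_valency_row_sum[OF assms(1), symmetric]
    by (intro sum.cong refl eproj_valency_const assms)
  then show ?thesis using nonempty fin by (simp add: field_simps)
qed

lemma eigen_mult_valency: "eigen_mult k = 1"
proof -
  have "of_nat (eigen_mult k) = (\<Sum>x\<in>V. 1 / of_nat (card V) :: complex)"
    unfolding trace_eproj[symmetric] by (intro sum.cong refl eproj_valency)
  also have "\<dots> = of_nat 1" using nonempty fin by simp
  finally show ?thesis by (simp only: of_nat_eq_iff)
qed

end

end

lemma cospectral_psd_matrix:
  fixes k :: real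
  assumes SG: "spectral_basis V A u lam" and SH: "spectral_basis W B w mu"
    and spec: "image_mset lam (mset_set {..<card V}) = image_mset mu (mset_set {..<card W})"
    and nonemptyG: "V \<noteq> {}" and nonemptyH: "W \<noteq> {}"
    and A01: "\<And>x y. x \<in> V \<Longrightarrow> y \<in> V \<Longrightarrow> A x y \<in> {0, 1}"
    and B01: "\<And>x y. x \<in> W \<Longrightarrow> y \<in> W \<Longrightarrow> B x y \<in> {0, 1}"
    and regularG: "\<And>x. x \<in> V \<Longrightarrow> (\<Sum>y\<in>V. A x y) = of_real k"
    and regularH: "\<And>x. x \<in> W \<Longrightarrow> (\<Sum>y\<in>W. B x y) = of_real k"
    and connectedG: "\<And>(f :: 'a \<Rightarrow> complex) x y. (\<And>x y. x \<in> V \<Longrightarrow> y \<in> V \<Longrightarrow> A x y = 1 \<Longrightarrow> f x = f y) \<Longrightarrow>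
      x \<in> V \<Longrightarrow> y \<in> V \<Longrightarrow> f x = f y"
    and connectedH: "\<And>(f :: 'b \<Rightarrow> complex) x y. (\<And>x y. x \<in> W \<Longrightarrow> y \<in> W \<Longrightarrow> B x y = 1 \<Longrightarrow> f x = f y) \<Longrightarrow>
      x \<in> W \<Longrightarrow> y \<in> W \<Longrightarrow> f x = f y"
    and diagG: "\<And>l. \<exists>a. \<forall>x\<in>V. kernel_power V A l x x = a"
    and diagH: "\<And>l. \<exists>a. \<forall>x\<in>W. kernel_power W B l x x = a"
    and adjG: "\<And>l. \<exists>b. \<forall>x\<in>V. \<forall>y\<in>V. A x y = 1 \<longrightarrow> kernel_power V A l x y = b"
    and adjH: "\<And>l. \<exists>b. \<forall>x\<in>W. \<forall>y\<in>W. B x y = 1 \<longrightarrow> kernel_power W B l x y = b"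
  shows "\<exists>M :: 'a \<times> 'b \<Rightarrow> 'a \<times> 'b \<Rightarrow> complex.
     psd_on (V \<times> W) M \<and>
     (\<forall>g\<in>V. \<forall>g'\<in>V. (\<Sum>h\<in>W. \<Sum>h'\<in>W. M (g, h) (g', h')) = 1) \<and>
     (\<forall>h\<in>W. \<forall>h'\<in>W. (\<Sum>g\<in>V. \<Sum>g'\<in>V. M (g, h) (g', h')) = 1) \<and>
     (\<forall>g\<in>V. \<forall>g'\<in>V. \<forall>h\<in>W. \<forall>h'\<in>W.
        (g = g') \<noteq> (h = h') \<or> A g g' \<noteq> B h h' \<longrightarrow> M (g, h) (g', h') = 0)"
proof -
  interpret G: spectral_basis V A u lam by (rule SG)
  interpret H: spectral_basis W B w mu by (rule SH)
  define S where "S = lam ` {..<card V}"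
  have S': "S = mu ` {..<card W}"
    using arg_cong[OF spec, of set_mset] by (simp add: S_def)
  have finS: "finite S" by (simp add: S_def)
  have eigen_mult: "H.eigen_mult c = G.eigen_mult c" for c
  proof -
    have "count (image_mset lam (mset_set {..<card V})) c = G.eigen_mult c"
      by (auto simp: count_image_mset' G.eigen_mult_def intro!: arg_cong[where f = card])
    moreover have "count (image_mset mu (mset_set {..<card W})) c = H.eigen_mult c"
      by (auto simp: count_image_mset' H.eigen_mult_def intro!: arg_cong[where f = card])
    ultimately show ?thesis using spec by simp
  qed
  have eigen_mult0: "G.eigen_mult c \<noteq> 0" if "c \<in> S" for c
    using G.eigen_mult_pos that by (simp add: S_def)
  \<comment> \<open>Dividing by the multiplicity cancels the factor in the entries of the
    \<open>G\<close> or \<open>H\<close> projection. It also keeps the weights non-negative, as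
    positive semidefiniteness requires.\<close>
  define M where "M = (\<lambda>p q. \<Sum>c\<in>S. of_real (1 / real (G.eigen_mult c)) *
    (G.eproj c (fst p) (fst q) * H.eproj c (snd p) (snd q)))"
  have "psd_on (V \<times> W) M"
    unfolding M_def
  proof (intro psd_on_sum psd_on_scale)
    fix c
    \<comment> \<open>The tensor product of two projections is the sum of the rank-one projections
      onto products of eigenvectors.\<close>
    have "(\<lambda>p q. G.eproj c (fst p) (fst q) * H.eproj c (snd p) (snd q))
      = (\<lambda>p q. \<Sum>i\<in>{i \<in> {..<card V}. lam i = c}. \<Sum>j\<in>{j \<in> {..<card W}. mu j = c}.
          (u i (fst p) * w j (snd p)) * cnj (u i (fst q) * w j (snd q)))"
      unfolding G.eproj_def H.eproj_def sum_product by (intro ext sum.cong refl) simp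
    then show "psd_on (V \<times> W) (\<lambda>p q. G.eproj c (fst p) (fst q) * H.eproj c (snd p) (snd q))"
      using psd_on_rank_one by (simp only:) (intro psd_on_sum psd_on_rank_one)
  qed simp
  moreover have "(\<Sum>h\<in>W. \<Sum>h'\<in>W. M (g, h) (g', h')) = 1" if g: "g \<in> V" "g' \<in> V" for g g'
  proof -
    have "(\<Sum>h\<in>W. \<Sum>h'\<in>W. M (g, h) (g', h'))
      = (\<Sum>h\<in>W. \<Sum>c\<in>S. of_real (1 / real (G.eigen_mult c)) * G.eproj c g g' * (\<Sum>h'\<in>W. H.eproj c h h'))"
      unfolding M_def fst_conv snd_conv
      by (intro sum.cong refl) (subst sum.swap, simp only: sum_distrib_left mult.assoc)
    \<comment> \<open>Only \<open>c = k\<close> has non-zero row sums in \<open>H\<close>; its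
      multiplicity is 1 and its entries in \<open>G\<close> are all
      \<open>1 / card V\<close>.\<close>
    also have "\<dots> = (\<Sum>h\<in>W. \<Sum>c\<in>S. if c = k then 1 / of_nat (card V) else 0)"
      using H.eproj_row_sum[OF nonemptyH B01 regularH connectedH]
        G.eproj_valency[OF nonemptyG A01 regularG connectedG g]
        G.eigen_mult_valency[OF nonemptyG A01 regularG connectedG]
      by (intro sum.cong refl) auto
    also have "\<dots> = of_nat (card W) / of_nat (card V)"
      using finS G.valency_eigenvalue[OF nonemptyG A01 regularG connectedG] by (simp add: S_def)
    also have "card W = card V"
      using arg_cong[OF spec, of size] by simp
    finally show ?thesis using nonemptyG G.fin by simp
  qed
  moreover have "(\<Sum>g\<in>V. \<Sum>g'\<in>V. M (g, h) (g', h')) = 1" if h: "h \<in> W" "h' \<in> W" for h h'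
  proof -
    have "(\<Sum>g\<in>V. \<Sum>g'\<in>V. M (g, h) (g', h'))
      = (\<Sum>g\<in>V. \<Sum>c\<in>S. of_real (1 / real (G.eigen_mult c)) * H.eproj c h h' * (\<Sum>g'\<in>V. G.eproj c g g'))"
      unfolding M_def fst_conv snd_conv
      by (intro sum.cong refl) (subst sum.swap, simp only: sum_distrib_left, intro sum.cong refl, simp only: mult_ac)
    also have "\<dots> = (\<Sum>g\<in>V. \<Sum>c\<in>S. if c = k then 1 / of_nat (card W) else 0)"
      using G.eproj_row_sum[OF nonemptyG A01 regularG connectedG]
        H.eproj_valency[OF nonemptyH B01 regularH connectedH h]
        G.eigen_mult_valency[OF nonemptyG A01 regularG connectedG]
      by (intro sum.cong refl) auto
    also have "\<dots> = of_nat (card V) / of_nat (card W)"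
      using finS G.valency_eigenvalue[OF nonemptyG A01 regularG connectedG] by (simp add: S_def)
    also have "card W = card V"
      using arg_cong[OF spec, of size] by simp
    finally show ?thesis using nonemptyG G.fin by simp
  qed
  moreover have "M (g, h) (g', h') = 0"
    if g: "g \<in> V" "g' \<in> V" and h: "h \<in> W" "h' \<in> W"
      and ne: "(g = g') \<noteq> (h = h') \<or> A g g' \<noteq> B h h'" for g g' h h'
  proof -
    \<comment> \<open>Used with \<open>l = 0\<close> and \<open>s\<close> the number of vertices if
      \<open>g = g'\<close>, and with \<open>l = 1\<close> and \<open>s\<close> the number of arcs
      if \<open>g\<close> and \<open>g'\<close> are adjacent. After cancellation the sum is an entry
      of the identity or of \<open>B\<close>. \<open>MH\<close> is the same with the graphs
      exchanged.\<close>
    have MG: "M (g, h) (g', h') = (\<Sum>c\<in>S. of_real (c ^ l) * H.eproj c h h') / s"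
      if "\<And>c. G.eproj c g g' = of_real (c ^ l) * of_nat (G.eigen_mult c) / s" for l s
      unfolding M_def fst_conv snd_conv sum_divide_distrib
    proof (intro sum.cong refl)
      fix c assume "c \<in> S"
      then have "G.eigen_mult c \<noteq> 0" by (rule eigen_mult0)
      then show "of_real (1 / real (G.eigen_mult c)) * (G.eproj c g g' * H.eproj c h h')
          = of_real (c ^ l) * H.eproj c h h' / s" using that[of c] by simp
    qed
    have MH: "M (g, h) (g', h') = (\<Sum>c\<in>S. of_real (c ^ l) * G.eproj c g g') / s"
      if "\<And>c. H.eproj c h h' = of_real (c ^ l) * of_nat (G.eigen_mult c) / s" for l s
      unfolding M_def fst_conv snd_conv sum_divide_distrib
    proof (intro sum.cong refl)
      fix c assume "c \<in> S"
      then have "G.eigen_mult c \<noteq> 0" by (rule eigen_mult0)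
      then show "of_real (1 / real (G.eigen_mult c)) * (G.eproj c g g' * H.eproj c h h')
          = of_real (c ^ l) * G.eproj c g g' / s" using that[of c] by simp
    qed
    \<comment> \<open>In each case one graph has an equal or adjacent pair, which determines its
      projection entries; the remaining sum over the other graph is a zero entry of its identity or
      adjacency matrix.\<close>
    consider "g = g'" "h \<noteq> h'" | "g \<noteq> g'" "h = h'" | "A g g' = 1" "B h h' = 0" | "A g g' = 0" "B h h' = 1"
      using ne A01[OF g] B01[OF h] by auto
    then show ?thesis
    proof cases
      case 1
      have "M (g, h) (g', h') = (\<Sum>c\<in>S. of_real (c ^ 0) * H.eproj c h h') / of_nat (card V)"
        by (rule MG) (simp add: 1 G.eproj_diagonal[OF diagG g(2)])
      then show ?thesis using H.eproj_sum[OF h, of 0] 1 by (simp add: S')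
    next
      case 2
      have "M (g, h) (g', h') = (\<Sum>c\<in>S. of_real (c ^ 0) * G.eproj c g g') / of_nat (card W)"
        by (rule MH) (simp add: 2 H.eproj_diagonal[OF diagH h(2)] eigen_mult)
      then show ?thesis using G.eproj_sum[OF g, of 0] 2 by (simp add: S_def)
    next
      case 3
      have "M (g, h) (g', h') = (\<Sum>c\<in>S. of_real (c ^ 1) * H.eproj c h h') / (\<Sum>x\<in>V. \<Sum>y\<in>V. A x y)"
        by (rule MG) (simp add: G.eproj_adjacent[OF adjG A01 g 3(1)])
      then show ?thesis using H.eproj_sum_mult[OF h] 3 by (simp add: S')
    next
      case 4
      have "M (g, h) (g', h') = (\<Sum>c\<in>S. of_real (c ^ 1) * G.eproj c g g') / (\<Sum>x\<in>W. \<Sum>y\<in>W. B x y)"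
        by (rule MH) (simp add: H.eproj_adjacent[OF adjH B01 h 4(2)] eigen_mult)
      then show ?thesis using G.eproj_sum_mult[OF g] 4 by (simp add: S_def)
    qed
  qed
  ultimately show ?thesis by (intro exI[of _ M]) blast
qed

section \<open>From a positive semidefinite matrix to the intertwining relation\<close>

text \<open>With \<open>r\<close> the image of \<open>z\<close> under \<open>M\<close>, the form at
  \<open>z\<close> minus \<open>t\<close> times \<open>r\<close> is
  \<open>- 2 * t * R + t\<^sup>2 * C\<close>, where \<open>R\<close> is the squared norm of
  \<open>r\<close>. It cannot stay non-negative for small positive \<open>t\<close> unless
  \<open>R\<close> is zero.\<close>

lemma psd_on_null_vector:
  assumes psd: "psd_on I M" and fin: "finite I"
    and null: "Re (\<Sum>i\<in>I. cnj (z i) * (\<Sum>j\<in>I. M i j * z j)) = 0" and "i \<in> I"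
  shows "(\<Sum>j\<in>I. M i j * z j) = 0"
proof -
  define r where "r = (\<lambda>i. \<Sum>j\<in>I. M i j * z j)"
  define s where "s = (\<lambda>i. \<Sum>j\<in>I. M i j * r j)"
  define R where "R = (\<Sum>i\<in>I. (cmod (r i))\<^sup>2)"
  define C where "C = Re (\<Sum>i\<in>I. cnj (r i) * s i)"
  have rr: "(\<Sum>i\<in>I. cnj (r i) * r i) = of_real R"
    unfolding R_def by (rule sum_cnj_mult_self)
  have zs: "(\<Sum>i\<in>I. cnj (z i) * s i) = of_real R"
  proof -
    have "(\<Sum>i\<in>I. cnj (z i) * s i) = (\<Sum>i\<in>I. cnj (\<Sum>j\<in>I. M i j * z j) * r i)"
      unfolding s_def by (rule hermitian_swap) (rule psd_on_hermitian[OF psd])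
    then show ?thesis unfolding rr[symmetric] by (simp only: r_def)
  qed
  have "0 \<le> - 2 * t * R + t\<^sup>2 * C" for t :: real
  proof -
    let ?x = "\<lambda>i. z i - of_real t * r i"
    have lin: "(\<Sum>j\<in>I. M i j * ?x j) = r i - of_real t * s i" for i
    proof -
      have "(\<Sum>j\<in>I. M i j * ?x j) = (\<Sum>j\<in>I. M i j * z j) - of_real t * s i"
        unfolding s_def sum_distrib_left sum_subtractf[symmetric]
        by (intro sum.cong refl) (simp add: right_diff_distrib mult.left_commute)
      then show ?thesis by (simp only: r_def)
    qed
    have "(\<Sum>i\<in>I. \<Sum>j\<in>I. cnj (?x i) * M i j * ?x j) = (\<Sum>i\<in>I. cnj (?x i) * (r i - of_real t * s i))"
      unfolding lin[symmetric] sum_distrib_left by (simp only: mult.assoc)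
    also have "\<dots> = (\<Sum>i\<in>I. cnj (z i) * r i) - of_real t * (\<Sum>i\<in>I. cnj (z i) * s i)
        - of_real t * (\<Sum>i\<in>I. cnj (r i) * r i) + of_real t * of_real t * (\<Sum>i\<in>I. cnj (r i) * s i)"
      unfolding sum_distrib_left sum_subtractf[symmetric] sum.distrib[symmetric]
      by (intro sum.cong refl) (simp add: algebra_simps)
    finally have "0 \<le> Re ((\<Sum>i\<in>I. cnj (z i) * r i) - of_real t * of_real R
        - of_real t * of_real R + of_real t * of_real t * (\<Sum>i\<in>I. cnj (r i) * s i))"
      using psd_on_nonneg[OF psd, of ?x] by (simp only: zs rr)
    moreover have "0 \<le> - 2 * t * R + t\<^sup>2 * Re b"
      if "0 \<le> Re (a - of_real t * of_real R - of_real t * of_real R + of_real t * of_real t * b)"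
        and "Re a = 0" for a b
      using that by (simp add: power2_eq_square mult_ac)
    ultimately show ?thesis
      using null unfolding C_def by (simp only: r_def)
  qed
  \<comment> \<open>For this \<open>t\<close> the quadratic term is at most \<open>t * R\<close>,
    too small to compensate for \<open>- 2 * t * R\<close>.\<close>
  from this[of "R / (\<bar>C\<bar> + 1)"]
  have *: "0 \<le> - 2 * (R / (\<bar>C\<bar> + 1)) * R + (R / (\<bar>C\<bar> + 1))\<^sup>2 * C" .
  have "R = 0"
  proof (rule ccontr)
    assume "R \<noteq> 0"
    moreover have "R \<ge> 0" unfolding R_def by (intro sum_nonneg) simp
    ultimately have R: "R > 0" by simp
    define t where "t = R / (\<bar>C\<bar> + 1)"
    have t: "t > 0" using R by (simp add: t_def add_nonneg_pos)
    have "0 \<le> t * (t * C - 2 * R)"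
      using * unfolding t_def[symmetric] by (simp add: power2_eq_square algebra_simps)
    then have "2 * R \<le> t * C" using t by (simp add: zero_le_mult_iff)
    also have "\<dots> \<le> t * (\<bar>C\<bar> + 1)" using t by (intro mult_left_mono) auto
    also have "\<dots> = R"
    proof -
      have "\<bar>C\<bar> + 1 \<noteq> 0" by linarith
      then show ?thesis by (simp add: t_def)
    qed
    finally show False using R by simp
  qed
  then have "r i = 0"
    using \<open>i \<in> I\<close> fin unfolding R_def by (subst (asm) sum_nonneg_eq_0_iff) auto
  then show ?thesis by (simp add: r_def)
qed

lemma kernel_power_Suc_left:
  assumes "finite V" "x \<in> V" "y \<in> V"
  shows "(\<Sum>z\<in>V. A x z * kernel_power V A l z y) = kernel_power V A (Suc l) x y"
  using assms(3)
proof (induction l arbitrary: y)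
  case 0
  then show ?case using assms(1,2)
    by (simp add: of_bool_def if_distrib[of "\<lambda>c. c * _"] if_distrib[of "(*) _"] cong: if_cong)
next
  case (Suc l)
  have "(\<Sum>z\<in>V. A x z * kernel_power V A (Suc l) z y)
      = (\<Sum>w\<in>V. (\<Sum>z\<in>V. A x z * kernel_power V A l z w) * A w y)"
    unfolding kernel_power.simps sum_distrib_left sum_distrib_right mult.assoc by (rule sum.swap)
  also have "\<dots> = (\<Sum>w\<in>V. kernel_power V A (Suc l) x w * A w y)"
    by (intro sum.cong refl) (simp only: Suc.IH)
  finally show ?case by simp
qed

text \<open>The condition on \<open>rel\<close> is split into equality and adjacency, so that either
  can be traded between the two graphs on its own.\<close>

locale psd_isomorphism =
  fixes V :: "'a set" and A :: "'a \<Rightarrow> 'a \<Rightarrow> complex"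
    and W :: "'b set" and B :: "'b \<Rightarrow> 'b \<Rightarrow> complex"
    and M :: "'a \<times> 'b \<Rightarrow> 'a \<times> 'b \<Rightarrow> complex"
  assumes finV: "finite V" and finW: "finite W"
    and A01: "\<And>x y. x \<in> V \<Longrightarrow> y \<in> V \<Longrightarrow> A x y \<in> {0, 1}"
    and B01: "\<And>x y. x \<in> W \<Longrightarrow> y \<in> W \<Longrightarrow> B x y \<in> {0, 1}"
    and symA: "\<And>x y. A y x = A x y"
    and symB: "\<And>x y. B y x = B x y"
    and psd: "psd_on (V \<times> W) M"
    and row_sum: "\<And>g g'. g \<in> V \<Longrightarrow> g' \<in> V \<Longrightarrow> (\<Sum>h\<in>W. \<Sum>h'\<in>W. M (g, h) (g', h')) = 1"
    and col_sum: "\<And>h h'. h \<in> W \<Longrightarrow> h' \<in> W \<Longrightarrow> (\<Sum>g\<in>V. \<Sum>g'\<in>V. M (g, h) (g', h')) = 1"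
    and zero_eq: "\<And>g g' h h'. g \<in> V \<Longrightarrow> g' \<in> V \<Longrightarrow> h \<in> W \<Longrightarrow> h' \<in> W \<Longrightarrow>
      (g = g') \<noteq> (h = h') \<Longrightarrow> M (g, h) (g', h') = 0"
    and zero_adj: "\<And>g g' h h'. g \<in> V \<Longrightarrow> g' \<in> V \<Longrightarrow> h \<in> W \<Longrightarrow> h' \<in> W \<Longrightarrow>
      A g g' \<noteq> B h h' \<Longrightarrow> M (g, h) (g', h') = 0"
begin

section \<open>Partial sums of the matrix\<close>

text \<open>By \<open>zero_eq\<close> the factors \<open>of_bool (g = g')\<close> and
  \<open>of_bool (h = h')\<close> are interchangeable in front of \<open>M\<close>. In terms of the
  Choi matrix this expresses trace preservation, and \<open>diag_col_sum\<close> unitality.\<close>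

lemma diag_row_sum:
  assumes "g \<in> V" "g' \<in> V"
  shows "(\<Sum>h\<in>W. M (g, h) (g', h)) = of_bool (g = g')"
proof -
  have "of_bool (g = g') = (\<Sum>h\<in>W. \<Sum>h'\<in>W. of_bool (g = g') * M (g, h) (g', h'))"
    using row_sum[OF assms] by (simp only: sum_distrib_left[symmetric] mult_1_right)
  also have "\<dots> = (\<Sum>h\<in>W. \<Sum>h'\<in>W. of_bool (h = h') * M (g, h) (g', h'))"
  proof (intro sum.cong refl)
    fix h h' assume "h \<in> W" "h' \<in> W"
    then show "of_bool (g = g') * M (g, h) (g', h') = of_bool (h = h') * M (g, h) (g', h')"
      using zero_eq[OF assms, of h h'] by (cases "g = g'"; cases "h = h'") simp_all
  qed
  also have "\<dots> = (\<Sum>h\<in>W. M (g, h) (g', h))"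
    using finW by (simp add: of_bool_def if_distrib[of "\<lambda>c. c * _"] cong: if_cong)
  finally show ?thesis by simp
qed

lemma diag_col_sum:
  assumes "h \<in> W" "h' \<in> W"
  shows "(\<Sum>g\<in>V. M (g, h) (g, h')) = of_bool (h = h')"
proof -
  have "of_bool (h = h') = (\<Sum>g\<in>V. \<Sum>g'\<in>V. of_bool (h = h') * M (g, h) (g', h'))"
    using col_sum[OF assms] by (simp only: sum_distrib_left[symmetric] mult_1_right)
  also have "\<dots> = (\<Sum>g\<in>V. \<Sum>g'\<in>V. of_bool (g = g') * M (g, h) (g', h'))"
  proof (intro sum.cong refl)
    fix g g' assume "g \<in> V" "g' \<in> V"
    then show "of_bool (h = h') * M (g, h) (g', h') = of_bool (g = g') * M (g, h) (g', h')"
      using zero_eq[OF _ _ assms, of g g'] by (cases "g = g'"; cases "h = h'") simp_all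
  qed
  also have "\<dots> = (\<Sum>g\<in>V. M (g, h) (g, h'))"
    using finV by (simp add: of_bool_def if_distrib[of "\<lambda>c. c * _"] cong: if_cong)
  finally show ?thesis by simp
qed

text \<open>Adjacency in \<open>H\<close> may be replaced by adjacency in \<open>G\<close> wherever
  it multiplies \<open>M\<close>, since \<open>M\<close> vanishes where the two differ.\<close>

lemma adj_swap:
  assumes "g \<in> V" "g' \<in> V" "h \<in> W" "h' \<in> W"
  shows "B h h' * M (g, h) (g', h') = A g g' * M (g, h) (g', h')"
  using zero_adj[OF assms] by (cases "A g g' = B h h'") simp_all

lemma adj_row_sum:
  assumes "g \<in> V" "g' \<in> V"
  shows "(\<Sum>h\<in>W. \<Sum>h'\<in>W. B h h' * M (g, h) (g', h')) = A g g'"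
proof -
  have "(\<Sum>h\<in>W. \<Sum>h'\<in>W. B h h' * M (g, h) (g', h')) = (\<Sum>h\<in>W. \<Sum>h'\<in>W. A g g' * M (g, h) (g', h'))"
    by (intro sum.cong refl adj_swap assms)
  then show ?thesis
    using row_sum[OF assms] by (simp only: sum_distrib_left[symmetric] mult_1_right)
qed

text \<open>The trace of \<open>M\<close> is computed by rows and by columns.\<close>

lemma card_eq: "card V = card W"
proof -
  have "(\<Sum>g\<in>V. \<Sum>h\<in>W. M (g, h) (g, h)) = of_nat (card V)"
    by (simp add: diag_row_sum)
  moreover have "(\<Sum>g\<in>V. \<Sum>h\<in>W. M (g, h) (g, h)) = of_nat (card W)"
    by (subst sum.swap) (simp add: diag_col_sum)
  ultimately show ?thesis by simp
qed

text \<open>Double counting: the sum of \<open>B h h' * M (g, h) (g', h')\<close> gives the arcs of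
  \<open>G\<close> when the pair in \<open>H\<close> is summed first, and those of \<open>H\<close>
  when the pair in \<open>G\<close> is.\<close>

lemma sum_adj_eq: "(\<Sum>g\<in>V. \<Sum>g'\<in>V. A g g') = (\<Sum>h\<in>W. \<Sum>h'\<in>W. B h h')"
proof -
  have "(\<Sum>g\<in>V. \<Sum>g'\<in>V. A g g')
      = (\<Sum>g\<in>V. \<Sum>g'\<in>V. \<Sum>h\<in>W. \<Sum>h'\<in>W. B h h' * M (g, h) (g', h'))"
    by (intro sum.cong refl) (simp add: adj_row_sum)
  also have "\<dots> = (\<Sum>g\<in>V. \<Sum>h\<in>W. \<Sum>g'\<in>V. \<Sum>h'\<in>W. B h h' * M (g, h) (g', h'))"
    by (intro sum.cong refl sum.swap)
  also have "\<dots> = (\<Sum>h\<in>W. \<Sum>g\<in>V. \<Sum>g'\<in>V. \<Sum>h'\<in>W. B h h' * M (g, h) (g', h'))"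
    by (rule sum.swap)
  also have "\<dots> = (\<Sum>h\<in>W. \<Sum>g\<in>V. \<Sum>h'\<in>W. \<Sum>g'\<in>V. B h h' * M (g, h) (g', h'))"
    by (intro sum.cong refl sum.swap)
  also have "\<dots> = (\<Sum>h\<in>W. \<Sum>h'\<in>W. \<Sum>g\<in>V. \<Sum>g'\<in>V. B h h' * M (g, h) (g', h'))"
    by (intro sum.cong refl sum.swap)
  also have "\<dots> = (\<Sum>h\<in>W. \<Sum>h'\<in>W. B h h')"
    by (intro sum.cong refl) (simp add: sum_distrib_left[symmetric] col_sum)
  finally show ?thesis .
qed

section \<open>The intertwining relation\<close>

definition defect :: "'a \<Rightarrow> 'b \<Rightarrow> 'a \<times> 'b \<Rightarrow> complex" where
  "defect g0 h0 p = (\<Sum>g\<in>V. M p (g, h0) * A g g0) - (\<Sum>h\<in>W. M p (g0, h) * B h h0)"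

text \<open>The difference of \<open>A\<close> tensor identity and identity tensor \<open>B\<close>,
  applied to the unit vector at \<open>(g0, h0)\<close>. Its image under \<open>M\<close> vanishes
  exactly when the intertwining relation holds at \<open>g0\<close> and \<open>h0\<close>.\<close>

definition test_vector :: "'a \<Rightarrow> 'b \<Rightarrow> 'a \<times> 'b \<Rightarrow> complex" where
  "test_vector g0 h0 q = of_bool (snd q = h0) * A (fst q) g0 - of_bool (fst q = g0) * B (snd q) h0"

lemma sum_test_vector:
  assumes "g0 \<in> V" "h0 \<in> W"
  shows "(\<Sum>q\<in>V \<times> W. F q * test_vector g0 h0 q)
    = (\<Sum>g\<in>V. F (g, h0) * A g g0) - (\<Sum>h\<in>W. F (g0, h) * B h h0)"
proof -
  have "(\<Sum>q\<in>V \<times> W. F q * test_vector g0 h0 q)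
      = (\<Sum>g\<in>V. \<Sum>h\<in>W. F (g, h) * (of_bool (h = h0) * A g g0))
      - (\<Sum>g\<in>V. \<Sum>h\<in>W. F (g, h) * (of_bool (g = g0) * B h h0))"
    unfolding test_vector_def sum_subtractf[symmetric] right_diff_distrib[symmetric]
    by (simp add: sum.cartesian_product case_prod_beta)
  also have "(\<Sum>g\<in>V. \<Sum>h\<in>W. F (g, h) * (of_bool (h = h0) * A g g0)) = (\<Sum>g\<in>V. F (g, h0) * A g g0)"
    using finW assms(2)
    by (simp add: of_bool_def if_distrib[of "\<lambda>c. c * _"] if_distrib[of "(*) _"] cong: if_cong)
  also have "(\<Sum>g\<in>V. \<Sum>h\<in>W. F (g, h) * (of_bool (g = g0) * B h h0)) = (\<Sum>h\<in>W. F (g0, h) * B h h0)"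
    using finV assms(1)
    by (subst sum.swap)
      (simp add: of_bool_def if_distrib[of "\<lambda>c. c * _"] if_distrib[of "(*) _"] cong: if_cong)
  finally show ?thesis .
qed

lemma cnj_test_vector:
  assumes "g0 \<in> V" "h0 \<in> W" "q \<in> V \<times> W"
  shows "cnj (test_vector g0 h0 q) = test_vector g0 h0 q"
  using A01[of "fst q" g0] B01[of "snd q" h0] assms by (auto simp: test_vector_def)

lemma idem_A: "g \<in> V \<Longrightarrow> g' \<in> V \<Longrightarrow> A g g' * A g g' = A g g'"
  using A01[of g g'] by auto

lemma idem_B: "h \<in> W \<Longrightarrow> h' \<in> W \<Longrightarrow> B h h' * B h h' = B h h'"
  using B01[of h h'] by auto

text \<open>Since \<open>M\<close> applied to \<open>test_vector g0 h0\<close> is \<open>defect g0 h0\<close>, this is the sum of the quadratic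
  form of \<open>M\<close> over all test vectors. Its four terms all equal the number of arcs and cancel.\<close>

lemma sum_defect_zero:
  "(\<Sum>g0\<in>V. \<Sum>h0\<in>W. \<Sum>p\<in>V \<times> W. defect g0 h0 p * test_vector g0 h0 p) = 0"
proof -
  define N where "N = (\<Sum>g\<in>V. \<Sum>g'\<in>V. A g g')"
  \<comment> \<open>Both factors come from \<open>A\<close>: the sum over \<open>h0\<close>
    collapses \<open>M\<close> by \<open>diag_row_sum\<close>, leaving squared entries of
    \<open>A\<close>, which are the entries themselves.\<close>
  have t1: "(\<Sum>g0\<in>V. \<Sum>h0\<in>W. \<Sum>g\<in>V. (\<Sum>g'\<in>V. M (g, h0) (g', h0) * A g' g0) * A g g0) = N"
  proof -
    have "(\<Sum>h0\<in>W. \<Sum>g\<in>V. (\<Sum>g'\<in>V. M (g, h0) (g', h0) * A g' g0) * A g g0) = (\<Sum>g\<in>V. A g0 g)"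
      if g0: "g0 \<in> V" for g0
    proof -
      have "(\<Sum>h0\<in>W. \<Sum>g\<in>V. (\<Sum>g'\<in>V. M (g, h0) (g', h0) * A g' g0) * A g g0)
          = (\<Sum>g\<in>V. (\<Sum>h0\<in>W. \<Sum>g'\<in>V. M (g, h0) (g', h0) * A g' g0) * A g g0)"
        by (subst sum.swap) (simp only: sum_distrib_right)
      also have "\<dots> = (\<Sum>g\<in>V. (\<Sum>g'\<in>V. of_bool (g = g') * A g' g0) * A g g0)"
        by (intro sum.cong refl arg_cong2[where f = "(*)"])
          (subst sum.swap, simp add: sum_distrib_right[symmetric] diag_row_sum)
      also have "\<dots> = (\<Sum>g\<in>V. A g0 g)"
      proof (intro sum.cong refl)
        fix g assume g: "g \<in> V"
        then have "(\<Sum>g'\<in>V. of_bool (g = g') * A g' g0) = A g g0"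
          using finV by (simp add: of_bool_def if_distrib[of "\<lambda>c. c * _"] cong: if_cong)
        then show "(\<Sum>g'\<in>V. of_bool (g = g') * A g' g0) * A g g0 = A g0 g"
          using idem_A[OF g g0] symA[of g g0] by simp
      qed
      finally show ?thesis .
    qed
    then show ?thesis by (simp add: N_def)
  qed
  \<comment> \<open>The mirror image of \<open>t1\<close>; it counts the arcs of \<open>H\<close>,
    of which there are equally many by \<open>sum_adj_eq\<close>.\<close>
  have t4: "(\<Sum>g0\<in>V. \<Sum>h0\<in>W. \<Sum>h\<in>W. (\<Sum>h'\<in>W. M (g0, h) (g0, h') * B h' h0) * B h h0) = N"
  proof -
    have "(\<Sum>g0\<in>V. \<Sum>h\<in>W. (\<Sum>h'\<in>W. M (g0, h) (g0, h') * B h' h0) * B h h0) = (\<Sum>h\<in>W. B h0 h)"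
      if h0: "h0 \<in> W" for h0
    proof -
      have "(\<Sum>g0\<in>V. \<Sum>h\<in>W. (\<Sum>h'\<in>W. M (g0, h) (g0, h') * B h' h0) * B h h0)
          = (\<Sum>h\<in>W. (\<Sum>g0\<in>V. \<Sum>h'\<in>W. M (g0, h) (g0, h') * B h' h0) * B h h0)"
        by (subst sum.swap) (simp only: sum_distrib_right)
      also have "\<dots> = (\<Sum>h\<in>W. (\<Sum>h'\<in>W. of_bool (h = h') * B h' h0) * B h h0)"
        by (intro sum.cong refl arg_cong2[where f = "(*)"])
          (subst sum.swap, simp add: sum_distrib_right[symmetric] diag_col_sum)
      also have "\<dots> = (\<Sum>h\<in>W. B h0 h)"
      proof (intro sum.cong refl)
        fix h assume h: "h \<in> W"
        then have "(\<Sum>h'\<in>W. of_bool (h = h') * B h' h0) = B h h0"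
          using finW by (simp add: of_bool_def if_distrib[of "\<lambda>c. c * _"] cong: if_cong)
        then show "(\<Sum>h'\<in>W. of_bool (h = h') * B h' h0) * B h h0 = B h0 h"
          using idem_B[OF h h0] symB[of h h0] by simp
      qed
      finally show ?thesis .
    qed
    then show ?thesis unfolding N_def sum_adj_eq by (subst sum.swap) simp
  qed
  \<comment> \<open>In the mixed terms the factor from \<open>B\<close> is summed against
    \<open>M\<close> over both vertices of \<open>H\<close>; \<open>adj_row_sum\<close> turns it
    into a second factor from \<open>A\<close>.\<close>
  have t2: "(\<Sum>g0\<in>V. \<Sum>h0\<in>W. \<Sum>g\<in>V. (\<Sum>h\<in>W. M (g, h0) (g0, h) * B h h0) * A g g0) = N"
  proof -
    have "(\<Sum>h0\<in>W. \<Sum>g\<in>V. (\<Sum>h\<in>W. M (g, h0) (g0, h) * B h h0) * A g g0) = (\<Sum>g\<in>V. A g0 g)"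
      if g0: "g0 \<in> V" for g0
    proof -
      have "(\<Sum>h0\<in>W. \<Sum>g\<in>V. (\<Sum>h\<in>W. M (g, h0) (g0, h) * B h h0) * A g g0)
          = (\<Sum>g\<in>V. (\<Sum>h0\<in>W. \<Sum>h\<in>W. B h0 h * M (g, h0) (g0, h)) * A g g0)"
        by (subst sum.swap) (simp only: sum_distrib_right symB mult.commute[of "B _ _" "M _ _"])
      also have "\<dots> = (\<Sum>g\<in>V. A g0 g)"
        by (intro sum.cong refl) (simp add: adj_row_sum g0 idem_A symA[of g0])
      finally show ?thesis .
    qed
    then show ?thesis by (simp add: N_def)
  qed
  have t3: "(\<Sum>g0\<in>V. \<Sum>h0\<in>W. \<Sum>h\<in>W. (\<Sum>g\<in>V. M (g0, h) (g, h0) * A g g0) * B h h0) = N"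
  proof -
    have "(\<Sum>h0\<in>W. \<Sum>h\<in>W. (\<Sum>g\<in>V. M (g0, h) (g, h0) * A g g0) * B h h0) = (\<Sum>g\<in>V. A g0 g)"
      if g0: "g0 \<in> V" for g0
    proof -
      have "(\<Sum>h0\<in>W. \<Sum>h\<in>W. (\<Sum>g\<in>V. M (g0, h) (g, h0) * A g g0) * B h h0)
          = (\<Sum>h\<in>W. \<Sum>h0\<in>W. \<Sum>g\<in>V. A g g0 * (B h h0 * M (g0, h) (g, h0)))"
        by (subst sum.swap, intro sum.cong refl, unfold sum_distrib_right, intro sum.cong refl)
          (simp only: mult_ac)
      also have "\<dots> = (\<Sum>h\<in>W. \<Sum>g\<in>V. \<Sum>h0\<in>W. A g g0 * (B h h0 * M (g0, h) (g, h0)))"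
        by (intro sum.cong refl sum.swap)
      also have "\<dots> = (\<Sum>g\<in>V. \<Sum>h\<in>W. \<Sum>h0\<in>W. A g g0 * (B h h0 * M (g0, h) (g, h0)))"
        by (rule sum.swap)
      also have "\<dots> = (\<Sum>g\<in>V. A g0 g)"
        by (intro sum.cong refl)
          (simp add: sum_distrib_left[symmetric] adj_row_sum g0 idem_A symA[of g0])
      finally show ?thesis .
    qed
    then show ?thesis by (simp add: N_def)
  qed
  have "(\<Sum>g0\<in>V. \<Sum>h0\<in>W. \<Sum>p\<in>V \<times> W. defect g0 h0 p * test_vector g0 h0 p)
      = (\<Sum>g0\<in>V. \<Sum>h0\<in>W. (\<Sum>g\<in>V. defect g0 h0 (g, h0) * A g g0) - (\<Sum>h\<in>W. defect g0 h0 (g0, h) * B h h0))"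
    by (intro sum.cong refl sum_test_vector)
  also have "\<dots> = (N - N) - (N - N)"
    unfolding defect_def left_diff_distrib sum_subtractf t1 t2 t3 t4 ..
  finally show ?thesis by simp
qed

text \<open>Non-negative values of the quadratic form with sum zero are all zero, so
  \<open>psd_on_null_vector\<close> applies to every test vector.\<close>

lemma intertwining:
  assumes p: "p \<in> V \<times> W" and g0: "g0 \<in> V" and h0: "h0 \<in> W"
  shows "(\<Sum>g\<in>V. M p (g, h0) * A g g0) = (\<Sum>h\<in>W. M p (g0, h) * B h h0)"
proof -
  define Q where "Q = (\<lambda>g0 h0. \<Sum>p\<in>V \<times> W. cnj (test_vector g0 h0 p) * (\<Sum>q\<in>V \<times> W. M p q * test_vector g0 h0 q))"
  have "Q g0 h0 = (\<Sum>p\<in>V \<times> W. defect g0 h0 p * test_vector g0 h0 p)" if "g0 \<in> V" "h0 \<in> W" for g0 h0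
    unfolding Q_def
    by (intro sum.cong refl)
      (simp add: cnj_test_vector[OF that] sum_test_vector[OF that] defect_def mult.commute)
  then have "(\<Sum>g0\<in>V. \<Sum>h0\<in>W. Q g0 h0) = 0"
    using sum_defect_zero by simp
  then have sum0: "(\<Sum>g0\<in>V. \<Sum>h0\<in>W. Re (Q g0 h0)) = 0"
    by (simp only: Re_sum[symmetric] zero_complex.sel)
  have nonneg: "0 \<le> Re (Q g0 h0)" for g0 h0
    using psd_on_nonneg[OF psd, of "test_vector g0 h0"]
    unfolding Q_def sum_distrib_left by (simp only: mult.assoc)
  have "(\<Sum>h0\<in>W. Re (Q g0 h0)) = 0"
    using sum0 g0 finV nonneg by (subst (asm) sum_nonneg_eq_0_iff) (auto intro: sum_nonneg)
  then have "Re (Q g0 h0) = 0"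
    using h0 finW nonneg by (subst (asm) sum_nonneg_eq_0_iff) auto
  then have "(\<Sum>q\<in>V \<times> W. M p q * test_vector g0 h0 q) = 0"
    using psd_on_null_vector[OF psd _ _ p] finV finW unfolding Q_def by blast
  then show ?thesis by (simp add: sum_test_vector[OF g0 h0])
qed

lemma intertwining_power:
  assumes p: "p \<in> V \<times> W" and "g0 \<in> V" and "h0 \<in> W"
  shows "(\<Sum>g\<in>V. M p (g, h0) * kernel_power V A l g g0) = (\<Sum>h\<in>W. M p (g0, h) * kernel_power W B l h h0)"
  using assms(2,3)
proof (induction l arbitrary: g0 h0)
  case 0
  then show ?case using finV finW
    by (simp add: of_bool_def if_distrib[of "(*) _"] cong: if_cong)
next
  case (Suc l)
  have "(\<Sum>g\<in>V. M p (g, h0) * kernel_power V A (Suc l) g g0)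
      = (\<Sum>z\<in>V. (\<Sum>g\<in>V. M p (g, h0) * kernel_power V A l g z) * A z g0)"
    unfolding kernel_power.simps sum_distrib_left sum_distrib_right mult.assoc by (rule sum.swap)
  also have "\<dots> = (\<Sum>z\<in>V. (\<Sum>h\<in>W. M p (z, h) * kernel_power W B l h h0) * A z g0)"
    using Suc.IH Suc.prems by (intro sum.cong refl) simp
  \<comment> \<open>The last factor from \<open>A\<close> now stands next to \<open>M\<close> and
    can be exchanged for a factor from \<open>B\<close>. That factor arrives on the left of the
    power, hence the use of \<open>kernel_power_Suc_left\<close>.\<close>
  also have "\<dots> = (\<Sum>h\<in>W. (\<Sum>z\<in>V. M p (z, h) * A z g0) * kernel_power W B l h h0)"
    unfolding sum_distrib_right by (subst sum.swap) (simp only: mult_ac)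
  also have "\<dots> = (\<Sum>h\<in>W. (\<Sum>h'\<in>W. M p (g0, h') * B h' h) * kernel_power W B l h h0)"
    using intertwining[OF p] Suc.prems by (intro sum.cong refl) simp
  also have "\<dots> = (\<Sum>h'\<in>W. M p (g0, h') * (\<Sum>h\<in>W. B h' h * kernel_power W B l h h0))"
    unfolding sum_distrib_right sum_distrib_left mult.assoc by (rule sum.swap)
  also have "\<dots> = (\<Sum>h'\<in>W. M p (g0, h') * kernel_power W B (Suc l) h' h0)"
    by (intro sum.cong refl) (simp only: kernel_power_Suc_left finW Suc.prems)
  finally show ?case .
qed

section \<open>Transfer of walk counts and connectedness\<close>

text \<open>The map with Choi matrix \<open>M\<close> sends powers of \<open>A\<close> to powers of
  \<open>B\<close>. Taking \<open>g0 = g\<close> in the intertwining relation and summing over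
  \<open>g\<close> collapses \<open>M\<close> by \<open>diag_col_sum\<close>.\<close>

lemma kernel_power_image:
  assumes "h \<in> W" "h' \<in> W"
  shows "kernel_power W B l h h' = (\<Sum>g\<in>V. \<Sum>g'\<in>V. M (g, h) (g', h') * kernel_power V A l g' g)"
proof -
  have "(\<Sum>g\<in>V. \<Sum>g'\<in>V. M (g, h) (g', h') * kernel_power V A l g' g)
      = (\<Sum>g\<in>V. \<Sum>h1\<in>W. M (g, h) (g, h1) * kernel_power W B l h1 h')"
    using assms by (intro sum.cong refl intertwining_power) auto
  also have "\<dots> = (\<Sum>h1\<in>W. (\<Sum>g\<in>V. M (g, h) (g, h1)) * kernel_power W B l h1 h')"
    by (subst sum.swap) (simp only: sum_distrib_right)
  also have "\<dots> = (\<Sum>h1\<in>W. of_bool (h = h1) * kernel_power W B l h1 h')"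
    using assms by (intro sum.cong refl) (simp add: diag_col_sum)
  also have "\<dots> = kernel_power W B l h h'"
    using assms finW by (simp add: of_bool_def if_distrib[of "\<lambda>c. c * _"] cong: if_cong)
  finally show ?thesis by simp
qed

text \<open>For an equal pair in \<open>H\<close>, \<open>M\<close> is supported on equal pairs in
  \<open>G\<close>. The power is constantly \<open>a\<close> there, and the weights sum to 1 by
  \<open>col_sum\<close>.\<close>

lemma kernel_power_diagonal:
  assumes a: "\<And>x. x \<in> V \<Longrightarrow> kernel_power V A l x x = a" and h: "h \<in> W"
  shows "kernel_power W B l h h = a"
proof -
  have "kernel_power W B l h h = (\<Sum>g\<in>V. \<Sum>g'\<in>V. M (g, h) (g', h) * a)"
    unfolding kernel_power_image[OF h h]
  proof (intro sum.cong refl)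
    fix g g' assume g: "g \<in> V" "g' \<in> V"
    then show "M (g, h) (g', h) * kernel_power V A l g' g = M (g, h) (g', h) * a"
      using zero_eq[OF g h h] a by (cases "g = g'") auto
  qed
  then show ?thesis using col_sum[OF h h] by (simp only: sum_distrib_right[symmetric] mult_1_left)
qed

lemma kernel_power_adjacent:
  assumes b: "\<And>x y. x \<in> V \<Longrightarrow> y \<in> V \<Longrightarrow> A x y = 1 \<Longrightarrow> kernel_power V A l x y = b"
    and h: "h \<in> W" "h' \<in> W" "B h h' = 1"
  shows "kernel_power W B l h h' = b"
proof -
  have "kernel_power W B l h h' = (\<Sum>g\<in>V. \<Sum>g'\<in>V. M (g, h) (g', h') * b)"
    unfolding kernel_power_image[OF h(1,2)]
  proof (intro sum.cong refl)
    fix g g' assume g: "g \<in> V" "g' \<in> V"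
    then show "M (g, h) (g', h') * kernel_power V A l g' g = M (g, h) (g', h') * b"
      using zero_adj[OF g h(1,2)] b[of g' g] symA[of g g'] h(3) by (cases "A g g' = 1") auto
  qed
  then show ?thesis using col_sum[OF h(1,2)] by (simp only: sum_distrib_right[symmetric] mult_1_left)
qed

text \<open>The dual map sends the matrix \<open>1\<^sub>C 1\<^sub>C\<^sup>T\<close> to a matrix \<open>Y\<close> whose rows are eigenvectors for the
  valency, so that \<open>Y\<close> is constant. Comparing trace and total sum gives \<open>card C = card V\<close>.\<close>

lemma connected_component_full:
  fixes k :: complex
  assumes nonempty: "V \<noteq> {}"
    and regularA: "\<And>x. x \<in> V \<Longrightarrow> (\<Sum>y\<in>V. A x y) = k"
    and regularB: "\<And>x. x \<in> W \<Longrightarrow> (\<Sum>y\<in>W. B x y) = k"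
    and connected: "\<And>(f :: 'a \<Rightarrow> complex) x y. (\<And>x y. x \<in> V \<Longrightarrow> y \<in> V \<Longrightarrow> A x y = 1 \<Longrightarrow> f x = f y) \<Longrightarrow>
      x \<in> V \<Longrightarrow> y \<in> V \<Longrightarrow> f x = f y"
    and C: "C \<subseteq> W" "C \<noteq> {}"
    and closed: "\<And>x y. x \<in> C \<Longrightarrow> y \<in> W \<Longrightarrow> B x y = 1 \<Longrightarrow> y \<in> C"
  shows "C = W"
proof -
  have finC: "finite C" using C(1) finW finite_subset by blast
  define Y where "Y = (\<lambda>g g'. \<Sum>h\<in>C. \<Sum>h'\<in>C. M (g, h) (g', h'))"
  \<comment> \<open>As \<open>C\<close> is closed under adjacency, its indicator function is an
    eigenvector of \<open>B\<close> for the valency.\<close>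
  have BC: "(\<Sum>h0\<in>C. B h h0) = (if h \<in> C then k else 0)" if h: "h \<in> W" for h
  proof (cases "h \<in> C")
    case True
    have "(\<Sum>h0\<in>C. B h h0) = (\<Sum>h0\<in>W. B h h0)"
      using C(1) finW B01[OF h] closed[OF True] by (intro sum.mono_neutral_left) auto
    then show ?thesis using True regularB[OF h] by simp
  next
    case False
    have "B h h0 = 0" if "h0 \<in> C" for h0
      using B01[OF h, of h0] closed[OF that h] symB[of h h0] False C(1) that by auto
    then show ?thesis using False by simp
  qed
  \<comment> \<open>Intertwining moves \<open>A\<close> across \<open>M\<close> to \<open>B\<close>,
    which acts on the indicator function of \<open>C\<close> as multiplication by
    \<open>k\<close>.\<close>
  have harmonic: "(\<Sum>g\<in>V. A g0 g * Y g1 g) = k * Y g1 g0" if g: "g0 \<in> V" "g1 \<in> V" for g0 g1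
  proof -
    have "(\<Sum>g\<in>V. A g0 g * Y g1 g) = (\<Sum>g\<in>V. \<Sum>h\<in>C. \<Sum>h0\<in>C. M (g1, h) (g, h0) * A g g0)"
      unfolding Y_def sum_distrib_left by (simp only: symA[of _ g0] mult.commute)
    also have "\<dots> = (\<Sum>h\<in>C. \<Sum>g\<in>V. \<Sum>h0\<in>C. M (g1, h) (g, h0) * A g g0)"
      by (rule sum.swap)
    also have "\<dots> = (\<Sum>h\<in>C. \<Sum>h0\<in>C. \<Sum>g\<in>V. M (g1, h) (g, h0) * A g g0)"
      by (intro sum.cong refl sum.swap)
    also have "\<dots> = (\<Sum>h\<in>C. \<Sum>h0\<in>C. \<Sum>h'\<in>W. M (g1, h) (g0, h') * B h' h0)"
      using g C(1) by (intro sum.cong refl intertwining) auto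
    also have "\<dots> = (\<Sum>h\<in>C. \<Sum>h'\<in>W. \<Sum>h0\<in>C. M (g1, h) (g0, h') * B h' h0)"
      by (intro sum.cong refl sum.swap)
    also have "\<dots> = (\<Sum>h\<in>C. \<Sum>h'\<in>W. if h' \<in> C then k * M (g1, h) (g0, h') else 0)"
      unfolding sum_distrib_left[symmetric] by (intro sum.cong refl) (simp add: BC)
    also have "\<dots> = (\<Sum>h\<in>C. \<Sum>h'\<in>C. k * M (g1, h) (g0, h'))"
    proof (rule sum.cong[OF refl])
      fix h
      show "(\<Sum>h'\<in>W. if h' \<in> C then k * M (g1, h) (g0, h') else 0) = (\<Sum>h'\<in>C. k * M (g1, h) (g0, h'))"
        using C(1) finW by (intro sum.mono_neutral_cong_right) auto
    qed
    finally show ?thesis unfolding Y_def sum_distrib_left .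
  qed
  have row: "Y g1 g = Y g1 g'" if g: "g \<in> V" "g' \<in> V" "g1 \<in> V" for g g' g1
  proof (rule connected)
    show "Y g1 x = Y g1 y" if "x \<in> V" "y \<in> V" "A x y = 1" for x y
      using harmonic_adjacent_equal[OF finV A01 symA regularA harmonic[OF _ g(3)] that] .
  qed fact+
  have hermY: "Y g' g = cnj (Y g g')" if g: "g \<in> V" "g' \<in> V" for g g'
  proof -
    have "Y g' g = (\<Sum>h'\<in>C. \<Sum>h\<in>C. M (g', h) (g, h'))"
      unfolding Y_def by (rule sum.swap)
    also have "\<dots> = (\<Sum>h'\<in>C. \<Sum>h\<in>C. cnj (M (g, h') (g', h)))"
      using g C(1) by (intro sum.cong refl psd_on_hermitian[OF psd]) auto
    finally show ?thesis by (simp add: Y_def)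
  qed
  obtain o1 where o1: "o1 \<in> V" using nonempty by blast
  \<comment> \<open>Rows are constant by connectedness of \<open>G\<close>; Hermitian symmetry
    carries this over to columns.\<close>
  have Yc: "Y g g' = Y o1 o1" if g: "g \<in> V" "g' \<in> V" for g g'
  proof -
    have "Y g g' = Y g o1" by (rule row[OF g(2) o1 g(1)])
    also have "\<dots> = cnj (Y o1 g)" by (rule hermY[OF o1 g(1)])
    also have "Y o1 g = Y o1 o1" by (rule row[OF g(1) o1 o1])
    also have "cnj (Y o1 o1) = Y o1 o1" by (rule hermY[OF o1 o1, symmetric])
    finally show ?thesis .
  qed
  have "(\<Sum>g\<in>V. Y g g) = (\<Sum>h\<in>C. \<Sum>h'\<in>C. of_bool (h = h'))"
  proof -
    have "(\<Sum>g\<in>V. Y g g) = (\<Sum>h\<in>C. \<Sum>g\<in>V. \<Sum>h'\<in>C. M (g, h) (g, h'))"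
      unfolding Y_def by (rule sum.swap)
    also have "\<dots> = (\<Sum>h\<in>C. \<Sum>h'\<in>C. \<Sum>g\<in>V. M (g, h) (g, h'))"
      by (intro sum.cong refl sum.swap)
    also have "\<dots> = (\<Sum>h\<in>C. \<Sum>h'\<in>C. of_bool (h = h'))"
      using C(1) by (intro sum.cong refl diag_col_sum) auto
    finally show ?thesis .
  qed
  also have "\<dots> = of_nat (card C)"
    using finC by (simp add: of_bool_def cong: if_cong)
  finally have trace: "of_nat (card V) * Y o1 o1 = of_nat (card C)"
    by (simp add: Yc)
  have "(\<Sum>g\<in>V. \<Sum>g'\<in>V. Y g g') = (\<Sum>h\<in>C. \<Sum>h'\<in>C. 1)"
  proof -
    have "(\<Sum>g\<in>V. \<Sum>g'\<in>V. Y g g') = (\<Sum>g\<in>V. \<Sum>h\<in>C. \<Sum>g'\<in>V. \<Sum>h'\<in>C. M (g, h) (g', h'))"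
      unfolding Y_def by (intro sum.cong refl sum.swap)
    also have "\<dots> = (\<Sum>h\<in>C. \<Sum>g\<in>V. \<Sum>g'\<in>V. \<Sum>h'\<in>C. M (g, h) (g', h'))"
      by (rule sum.swap)
    also have "\<dots> = (\<Sum>h\<in>C. \<Sum>g\<in>V. \<Sum>h'\<in>C. \<Sum>g'\<in>V. M (g, h) (g', h'))"
      by (intro sum.cong refl sum.swap)
    also have "\<dots> = (\<Sum>h\<in>C. \<Sum>h'\<in>C. \<Sum>g\<in>V. \<Sum>g'\<in>V. M (g, h) (g', h'))"
      by (intro sum.cong refl sum.swap)
    also have "\<dots> = (\<Sum>h\<in>C. \<Sum>h'\<in>C. 1)"
      using C(1) by (intro sum.cong refl col_sum) auto
    finally show ?thesis .
  qed
  then have total: "of_nat (card V) * (of_nat (card V) * Y o1 o1) = of_nat (card C * card C)"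
    by (simp add: Yc)
  \<comment> \<open>Writing y for the constant entry of \<open>Y\<close>, the trace is
    \<open>card V\<close> times y and equals \<open>card C\<close>; the total sum is
    \<open>card V\<close> squared times y and equals \<open>card C\<close> squared. Eliminating y
    gives this equation.\<close>
  have "of_nat (card V * card C) = (of_nat (card C * card C) :: complex)"
    using total unfolding trace by simp
  then have "card V * card C = card C * card C" by (simp only: of_nat_eq_iff)
  then have "card C = card W" using C(2) finC card_eq by simp
  then show ?thesis using C(1) finW card_subset_eq by blast
qed

end

section \<open>Graphs and their adjacency matrices\<close>

text \<open>Combining the power sums with the coefficients of a polynomial that isolates
  \<open>c\<close> within both lists yields the multiplicity of \<open>c\<close>.\<close>

lemma power_sums_determine_multiset:
  fixes lam mu :: "nat \<Rightarrow> real"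
  assumes "\<And>l. (\<Sum>i<n. lam i ^ l) = (\<Sum>j<m. mu j ^ l)"
  shows "image_mset lam (mset_set {..<n}) = image_mset mu (mset_set {..<m})"
proof (rule multiset_eqI)
  fix c
  obtain p :: "real poly"
    where p: "\<And>x. x \<in> lam ` {..<n} \<union> mu ` {..<m} \<Longrightarrow> poly p x = of_bool (x = c)"
    using interpolating_polynomial[of "lam ` {..<n} \<union> mu ` {..<m}" c] by auto
  have count: "real (count (image_mset f (mset_set {..<N})) c)
      = (\<Sum>l\<le>degree p. coeff p l * (\<Sum>i<N. f i ^ l))"
    if "f ` {..<N} \<subseteq> lam ` {..<n} \<union> mu ` {..<m}" for f :: "nat \<Rightarrow> real" and N
  proof -
    have "(\<Sum>l\<le>degree p. coeff p l * (\<Sum>i<N. f i ^ l)) = (\<Sum>i<N. poly p (f i))"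
      unfolding poly_altdef sum_distrib_left by (rule sum.swap)
    also have "\<dots> = (\<Sum>i<N. of_bool (f i = c))"
      using that by (intro sum.cong refl p) auto
    also have "\<dots> = real (card {i \<in> {..<N}. f i = c})"
      by (simp add: of_bool_def sum.If_cases Int_def)
    also have "card {i \<in> {..<N}. f i = c} = count (image_mset f (mset_set {..<N})) c"
      by (auto simp: count_image_mset' intro!: arg_cong[where f = card])
    finally show ?thesis by simp
  qed
  have "real (count (image_mset lam (mset_set {..<n})) c) = real (count (image_mset mu (mset_set {..<m})) c)"
    by (simp add: count assms)
  then show "count (image_mset lam (mset_set {..<n})) c = count (image_mset mu (mset_set {..<m})) c"
    by simp
qed

section \<open>Matrix identities entry by entry\<close>

lemma indexed_mat_eq_iff:
  assumes "finite V"
  shows "indexed_mat V P = indexed_mat V Q \<longleftrightarrow> (\<forall>x\<in>V. \<forall>y\<in>V. P x y = Q x y)"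
proof
  assume eq: "indexed_mat V P = indexed_mat V Q"
  show "\<forall>x\<in>V. \<forall>y\<in>V. P x y = Q x y"
  proof (intro ballI)
    fix x y assume "x \<in> V" "y \<in> V"
    obtain i where "i < card V" "x = from_nat_into V i"
      using obtain_index[OF assms \<open>x \<in> V\<close>] .
    moreover obtain j where "j < card V" "y = from_nat_into V j"
      using obtain_index[OF assms \<open>y \<in> V\<close>] .
    ultimately show "P x y = Q x y"
      using arg_cong[OF eq, of "\<lambda>X. X $$ (i, j)"] by (simp add: indexed_mat_def)
  qed
next
  assume "\<forall>x\<in>V. \<forall>y\<in>V. P x y = Q x y"
  then show "indexed_mat V P = indexed_mat V Q"
    by (intro eq_matI) (auto simp: indexed_mat_def from_nat_into_in)
qed

lemma one_mat_indexed:
  assumes "finite V"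
  shows "1\<^sub>m (card V) = indexed_mat V (\<lambda>x y. of_bool (x = y))"
  using bij_betw_from_nat_into_finite[OF assms]
  by (intro eq_matI) (auto simp: indexed_mat_def bij_betw_def inj_on_def)

lemma schur_prod_indexed:
  "indexed_mat V P \<bullet>\<^sub>m indexed_mat V Q = indexed_mat V (\<lambda>x y. P x y * Q x y)"
  by (intro eq_matI) (auto simp: indexed_mat_def schur_prod_def)

lemma smult_indexed: "c \<cdot>\<^sub>m indexed_mat V P = indexed_mat V (\<lambda>x y. c * P x y)"
  by (intro eq_matI) (auto simp: indexed_mat_def)

lemma pow_mat_indexed:
  assumes "finite V"
  shows "indexed_mat V A ^\<^sub>m l = indexed_mat V (kernel_power V A l)"
proof (induction l)
  case 0
  then show ?case
    using one_mat_indexed[OF assms] by (simp add: indexed_mat_def)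
next
  case (Suc l)
  show ?case
  proof (rule eq_matI)
    fix i j assume "i < dim_row (indexed_mat V (kernel_power V A (Suc l)))"
      "j < dim_col (indexed_mat V (kernel_power V A (Suc l)))"
    then have "i < card V" "j < card V" by (simp_all add: indexed_mat_def)
    then show "(indexed_mat V A ^\<^sub>m Suc l) $$ (i, j) = indexed_mat V (kernel_power V A (Suc l)) $$ (i, j)"
      by (simp add: Suc.IH, simp add: indexed_mat_def scalar_prod_def lessThan_atLeast0
          sum_from_nat_into[OF assms])
  qed (simp_all add: Suc.IH, simp_all add: indexed_mat_def)
qed

definition adjacency :: "'a pair_pre_digraph \<Rightarrow> 'a \<Rightarrow> 'a \<Rightarrow> complex" where
  "adjacency G x y = of_bool ((x, y) \<in> parcs G)"

lemma adjacency_01: "adjacency G x y \<in> {0, 1}"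
  by (simp add: adjacency_def)

lemma adj_mat_indexed: "adj_mat G = indexed_mat (pverts G) (adjacency G)"
  by (intro eq_matI) (auto simp: adj_mat_def indexed_mat_def adjacency_def Let_def)

text \<open>A Schur product with the identity or with the adjacency matrix masks all entries except
  those on the diagonal or on arcs.\<close>

lemma one_walk_regular_iff:
  assumes "finite (pverts G)"
  shows "one_walk_regular G \<longleftrightarrow>
    (\<forall>l. \<exists>a::nat. \<forall>x\<in>pverts G. kernel_power (pverts G) (adjacency G) l x x = of_nat a) \<and>
    (\<forall>l. \<exists>b::nat. \<forall>x\<in>pverts G. \<forall>y\<in>pverts G. adjacency G x y = 1 \<longrightarrow>
      kernel_power (pverts G) (adjacency G) l x y = of_nat b)"
proof -
  have 1: "(\<forall>x\<in>V. \<forall>y\<in>V. of_bool (x = y) * P x y = c * of_bool (x = y)) \<longleftrightarrow> (\<forall>x\<in>V. P x x = c)"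
    for V :: "'a set" and P and c :: complex
    by (auto simp: of_bool_def)
  have 2: "adjacency G x y * P = c * adjacency G x y \<longleftrightarrow> (adjacency G x y = 1 \<longrightarrow> P = c)"
    for x y and P c :: complex
    using adjacency_01[of G x y] by auto
  show ?thesis
    unfolding one_walk_regular_def walk_regular_def adj_mat_indexed one_mat_indexed[OF assms]
      pow_mat_indexed[OF assms] schur_prod_indexed smult_indexed indexed_mat_eq_iff[OF assms] 1 2 ..
qed

section \<open>Valency, connectedness and spectrum of a graph\<close>

lemma adjacency_sym:
  assumes "pair_graph G"
  shows "adjacency G y x = adjacency G x y"
proof -
  interpret pair_graph G by (rule assms)
  show ?thesis
    using pair_sym_arcs by (auto simp: adjacency_def symmetric_def sym_def)
qed

text \<open>The closed walks of length 2 at \<open>x\<close> correspond to its neighbours.\<close>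

lemma adjacency_regular:
  assumes "pair_graph G" and x: "x \<in> pverts G"
    and "kernel_power (pverts G) (adjacency G) 2 x x = k"
  shows "(\<Sum>y\<in>pverts G. adjacency G x y) = k"
proof -
  interpret pair_graph G by (rule assms(1))
  have "(\<Sum>y\<in>pverts G. adjacency G x y) = (\<Sum>y\<in>pverts G. adjacency G x y * adjacency G y x)"
  proof (intro sum.cong refl)
    fix y
    show "adjacency G x y = adjacency G x y * adjacency G y x"
      using adjacency_01[of G x y] adjacency_sym[OF assms(1), of y x] by auto
  qed
  then show ?thesis
    using kernel_power_2[OF pair_finite_verts x, of "adjacency G" x] assms(3) by simp
qed

text \<open>Connectedness refers to the symmetric closure, which for a \<open>pair_graph\<close> has
  the same reachability; then \<open>f\<close> is followed along a path.\<close>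

lemma connected_constant:
  assumes conn: "Digraph_Component.connected (with_proj G)" and G: "pair_graph G"
    and f: "\<And>x y. x \<in> pverts G \<Longrightarrow> y \<in> pverts G \<Longrightarrow> adjacency G x y = 1 \<Longrightarrow> f x = f y"
    and "x \<in> pverts G" "y \<in> pverts G"
  shows "f x = f y"
proof -
  interpret pair_graph G by (rule G)
  have "x \<rightarrow>\<^sup>*\<^bsub>with_proj (mk_symmetric (with_proj G))\<^esub> y"
    using conn assms(4,5) by (auto simp: Digraph_Component.connected_def strongly_connected_def)
  then have "x \<rightarrow>\<^sup>*\<^bsub>with_proj G\<^esub> y"
    using reachable_mk_symmetric_eq pair_sym_arcs by simp
  then have "(x, y) \<in> (parcs G)\<^sup>*"
    using reachable_rtranclI[of "with_proj G" x y] by simp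
  then show ?thesis
  proof (induction rule: rtrancl_induct)
    case (step y z)
    then show ?case
      using f[of y z] arc_fst_in_verts[of "(y, z)"] arc_snd_in_verts[of "(y, z)"]
      by (simp add: adjacency_def)
  qed simp
qed

text \<open>The assumption is applied to the set of vertices reachable from a given vertex.\<close>

lemma connectedI_components:
  assumes G: "pair_graph G" and "pverts G \<noteq> {}"
    and full: "\<And>C. C \<subseteq> pverts G \<Longrightarrow> C \<noteq> {} \<Longrightarrow>
      (\<And>x y. x \<in> C \<Longrightarrow> y \<in> pverts G \<Longrightarrow> adjacency G x y = 1 \<Longrightarrow> y \<in> C) \<Longrightarrow> C = pverts G"
  shows "Digraph_Component.connected (with_proj G)"
proof -
  interpret pair_graph G by (rule G)
  have "u \<rightarrow>\<^sup>*\<^bsub>with_proj G\<^esub> v" if "u \<in> pverts G" "v \<in> pverts G" for u v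
  proof -
    have "{w \<in> pverts G. u \<rightarrow>\<^sup>*\<^bsub>with_proj G\<^esub> w} = pverts G"
    proof (rule full)
      fix x y
      assume "x \<in> {w \<in> pverts G. u \<rightarrow>\<^sup>*\<^bsub>with_proj G\<^esub> w}" "y \<in> pverts G" "adjacency G x y = 1"
      then show "y \<in> {w \<in> pverts G. u \<rightarrow>\<^sup>*\<^bsub>with_proj G\<^esub> w}"
        using reachable_adj_trans[of u x y] by (simp add: adjacency_def)
    qed (use that in auto)
    then show ?thesis using that(2) by blast
  qed
  then show ?thesis
    using assms(2) reachable_mk_symmetric_eq pair_sym_arcs
    by (simp add: Digraph_Component.connected_def strongly_connected_def)
qed

lemma connected_nonempty:
  "Digraph_Component.connected (with_proj G) \<Longrightarrow> pverts G \<noteq> {}"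
  by (auto simp: Digraph_Component.connected_def strongly_connected_def)

text \<open>As there are no loops, equal vertices are never adjacent, so equality and adjacency
  together encode the three values of \<open>rel\<close>.\<close>

lemma rel_eq_iff:
  assumes "pair_graph G" "pair_graph H"
  shows "rel G g g' = rel H h h' \<longleftrightarrow>
    ((g = g') = (h = h')) \<and> adjacency G g g' = adjacency H h h'"
proof -
  interpret G: pair_graph G by (rule assms)
  interpret H: pair_graph H by (rule assms)
  show ?thesis
    using G.pair_no_loops[of "(g, g')"] H.pair_no_loops[of "(h, h')"]
    by (auto simp: rel_def adjacency_def)
qed

lemma obtain_adjacency_spectrum:
  assumes "pair_graph G"
  obtains u lam where "spectral_basis (pverts G) (adjacency G) u lam"
    and "eigenvalue_mset (adj_mat G)
      = image_mset (\<lambda>i. complex_of_real (lam i)) (mset_set {..<card (pverts G)})"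
proof -
  interpret pair_graph G by (rule assms)
  have "adjacency G y x = cnj (adjacency G x y)" for x y
    using adjacency_sym[OF assms, of y x] by (simp add: adjacency_def)
  then show thesis
    using spectral_theorem[OF pair_finite_verts, of "adjacency G"] that unfolding adj_mat_indexed by metis
qed

lemma image_mset_of_real_cancel:
  assumes "image_mset (\<lambda>i. complex_of_real (f i)) I = image_mset (\<lambda>j. complex_of_real (g j)) J"
  shows "image_mset f I = image_mset g J"
  using arg_cong[OF assms, of "image_mset Re"] by (simp add: multiset.map_comp o_def)

section \<open>The two implications\<close>

lemma psd_isomorphic_imp:
  assumes G: "pair_graph G" and connG: "Digraph_Component.connected (with_proj G)"
    and regG: "one_walk_regular G" and H: "pair_graph H" and iso: "G \<cong>\<^sub>S\<^sub>+ H"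
  shows "Digraph_Component.connected (with_proj H) \<and> one_walk_regular H \<and> cospectral G H"
proof -
  interpret G: pair_graph G by (rule G)
  interpret H: pair_graph H by (rule H)
  let ?V = "pverts G" and ?W = "pverts H" and ?A = "adjacency G" and ?B = "adjacency H"
  obtain M where M: "psd_on (?V \<times> ?W) M"
    "\<forall>g\<in>?V. \<forall>g'\<in>?V. (\<Sum>h\<in>?W. \<Sum>h'\<in>?W. M (g, h) (g', h')) = 1"
    "\<forall>h\<in>?W. \<forall>h'\<in>?W. (\<Sum>g\<in>?V. \<Sum>g'\<in>?V. M (g, h) (g', h')) = 1"
    "\<forall>g\<in>?V. \<forall>g'\<in>?V. \<forall>h\<in>?W. \<forall>h'\<in>?W. rel G g g' \<noteq> rel H h h' \<longrightarrow> M (g, h) (g', h') = 0"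
    using iso unfolding psd_isomorphic_def by (elim exE conjE) (rule that)
  interpret psd_isomorphism ?V ?A ?W ?B M
  proof
    show "M (g, h) (g', h') = 0"
      if "g \<in> ?V" "g' \<in> ?V" "h \<in> ?W" "h' \<in> ?W" "(g = g') \<noteq> (h = h')" for g g' h h'
      using M(4) that rel_eq_iff[OF G H, of g g' h h'] by blast
    show "M (g, h) (g', h') = 0"
      if "g \<in> ?V" "g' \<in> ?V" "h \<in> ?W" "h' \<in> ?W" "?A g g' \<noteq> ?B h h'" for g g' h h'
      using M(4) that rel_eq_iff[OF G H, of g g' h h'] by blast
  qed (use M in \<open>simp_all add: G.pair_finite_verts H.pair_finite_verts adjacency_01
      adjacency_sym[OF G] adjacency_sym[OF H] del: insert_iff\<close>)
  obtain a where a: "\<And>l x. x \<in> ?V \<Longrightarrow> kernel_power ?V ?A l x x = of_nat (a l)"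
    using regG unfolding one_walk_regular_iff[OF G.pair_finite_verts] by metis
  obtain b where b: "\<And>l x y. x \<in> ?V \<Longrightarrow> y \<in> ?V \<Longrightarrow> ?A x y = 1 \<Longrightarrow> kernel_power ?V ?A l x y = of_nat (b l)"
    using regG unfolding one_walk_regular_iff[OF G.pair_finite_verts] by metis
  have aH: "kernel_power ?W ?B l x x = of_nat (a l)" if "x \<in> ?W" for l x
    by (rule kernel_power_diagonal[OF a that])
  have bH: "kernel_power ?W ?B l x y = of_nat (b l)" if "x \<in> ?W" "y \<in> ?W" "?B x y = 1" for l x y
    by (rule kernel_power_adjacent[OF b that])
  have neV: "?V \<noteq> {}" by (rule connected_nonempty[OF connG])
  then have neW: "?W \<noteq> {}"
    using card_eq G.pair_finite_verts by auto
  have "Digraph_Component.connected (with_proj H)"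
  proof (rule connectedI_components[OF H neW])
    fix C assume C: "C \<subseteq> ?W" "C \<noteq> {}"
      and closed: "\<And>x y. x \<in> C \<Longrightarrow> y \<in> ?W \<Longrightarrow> ?B x y = 1 \<Longrightarrow> y \<in> C"
    show "C = ?W"
    proof (rule connected_component_full[OF neV _ _ _ C closed])
      show "(\<Sum>y\<in>?V. ?A x y) = of_nat (a 2)" if "x \<in> ?V" for x
        by (rule adjacency_regular[OF G that a[OF that]])
      show "(\<Sum>y\<in>?W. ?B x y) = of_nat (a 2)" if "x \<in> ?W" for x
        by (rule adjacency_regular[OF H that aH[OF that]])
      show "f x = f y"
        if "\<And>x y. x \<in> ?V \<Longrightarrow> y \<in> ?V \<Longrightarrow> ?A x y = 1 \<Longrightarrow> f x = f y" "x \<in> ?V" "y \<in> ?V"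
        for f :: "'a \<Rightarrow> complex" and x y
        using connected_constant[OF connG G, of f x y] that by blast
    qed
  qed
  moreover have "one_walk_regular H"
    unfolding one_walk_regular_iff[OF H.pair_finite_verts] using aH bH by blast
  moreover have "cospectral G H"
  proof -
    obtain u lam where SG: "spectral_basis ?V ?A u lam"
      and specG: "eigenvalue_mset (adj_mat G) = image_mset (\<lambda>i. complex_of_real (lam i)) (mset_set {..<card ?V})"
      using obtain_adjacency_spectrum[OF G] .
    obtain w mu where SH: "spectral_basis ?W ?B w mu"
      and specH: "eigenvalue_mset (adj_mat H) = image_mset (\<lambda>i. complex_of_real (mu i)) (mset_set {..<card ?W})"
      using obtain_adjacency_spectrum[OF H] .
    \<comment> \<open>The power sums of the eigenvalues are traces of powers, which agree because
      the diagonals and the numbers of vertices do.\<close>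
    have "(\<Sum>i<card ?V. lam i ^ l) = (\<Sum>i<card ?W. mu i ^ l)" for l
    proof -
      have "complex_of_real (\<Sum>i<card ?V. lam i ^ l) = (\<Sum>x\<in>?V. kernel_power ?V ?A l x x)"
        using spectral_basis.trace_kernel_power[OF SG] by simp
      also have "\<dots> = (\<Sum>x\<in>?W. kernel_power ?W ?B l x x)"
        by (simp add: a aH card_eq)
      also have "\<dots> = complex_of_real (\<Sum>i<card ?W. mu i ^ l)"
        using spectral_basis.trace_kernel_power[OF SH] by simp
      finally show ?thesis by (simp only: of_real_eq_iff)
    qed
    then have "image_mset lam (mset_set {..<card ?V}) = image_mset mu (mset_set {..<card ?W})"
      by (rule power_sums_determine_multiset)
    from arg_cong[OF this, of "image_mset complex_of_real"] show ?thesis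
      by (simp add: cospectral_def specG specH multiset.map_comp o_def)
  qed
  ultimately show ?thesis by blast
qed

lemma cospectral_imp_psd_isomorphic:
  assumes G: "pair_graph G" and connG: "Digraph_Component.connected (with_proj G)"
    and regG: "one_walk_regular G"
    and H: "pair_graph H" and connH: "Digraph_Component.connected (with_proj H)"
    and regH: "one_walk_regular H" and cosp: "cospectral G H"
  shows "G \<cong>\<^sub>S\<^sub>+ H"
proof -
  interpret G: pair_graph G by (rule G)
  interpret H: pair_graph H by (rule H)
  let ?V = "pverts G" and ?W = "pverts H" and ?A = "adjacency G" and ?B = "adjacency H"
  obtain a where a: "\<And>l x. x \<in> ?V \<Longrightarrow> kernel_power ?V ?A l x x = of_nat (a l)"
    using regG unfolding one_walk_regular_iff[OF G.pair_finite_verts] by metis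
  obtain a' where a': "\<And>l x. x \<in> ?W \<Longrightarrow> kernel_power ?W ?B l x x = of_nat (a' l)"
    using regH unfolding one_walk_regular_iff[OF H.pair_finite_verts] by metis
  have neV: "?V \<noteq> {}" by (rule connected_nonempty[OF connG])
  have neW: "?W \<noteq> {}" by (rule connected_nonempty[OF connH])
  obtain u lam where SG: "spectral_basis ?V ?A u lam"
    and specG: "eigenvalue_mset (adj_mat G) = image_mset (\<lambda>i. complex_of_real (lam i)) (mset_set {..<card ?V})"
    using obtain_adjacency_spectrum[OF G] .
  obtain w mu where SH: "spectral_basis ?W ?B w mu"
    and specH: "eigenvalue_mset (adj_mat H) = image_mset (\<lambda>i. complex_of_real (mu i)) (mset_set {..<card ?W})"
    using obtain_adjacency_spectrum[OF H] .
  have spec: "image_mset lam (mset_set {..<card ?V}) = image_mset mu (mset_set {..<card ?W})"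
    using cosp by (intro image_mset_of_real_cancel) (simp only: cospectral_def specG specH)
  have card: "card ?V = card ?W"
    using arg_cong[OF spec, of size] by simp
  \<comment> \<open>The trace of the squared adjacency matrix is the number of vertices times the
    valency. Cospectral graphs share the trace and the number of vertices, hence the
    valency.\<close>
  have valency: "a 2 = a' 2"
  proof -
    have "(\<Sum>i<card ?V. (lam i)\<^sup>2) = (\<Sum>i<card ?W. (mu i)\<^sup>2)"
      using arg_cong[OF spec, of "\<lambda>X. \<Sum>\<^sub># (image_mset power2 X)"]
      by (simp add: sum_unfold_sum_mset multiset.map_comp o_def)
    then have "(\<Sum>i<card ?V. complex_of_real ((lam i)\<^sup>2)) = (\<Sum>i<card ?W. complex_of_real ((mu i)\<^sup>2))"
      by (simp only: of_real_sum[symmetric])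
    then have "(\<Sum>x\<in>?V. kernel_power ?V ?A 2 x x) = (\<Sum>x\<in>?W. kernel_power ?W ?B 2 x x)"
      by (simp only: spectral_basis.trace_kernel_power[OF SG] spectral_basis.trace_kernel_power[OF SH])
    then have "complex_of_nat (card ?W * a 2) = of_nat (card ?W * a' 2)"
      by (simp add: a a' card)
    then show ?thesis
      using neW H.pair_finite_verts by (simp only: of_nat_eq_iff) simp
  qed
  have "\<exists>M :: 'a \<times> 'b \<Rightarrow> 'a \<times> 'b \<Rightarrow> complex.
     psd_on (?V \<times> ?W) M \<and>
     (\<forall>g\<in>?V. \<forall>g'\<in>?V. (\<Sum>h\<in>?W. \<Sum>h'\<in>?W. M (g, h) (g', h')) = 1) \<and>
     (\<forall>h\<in>?W. \<forall>h'\<in>?W. (\<Sum>g\<in>?V. \<Sum>g'\<in>?V. M (g, h) (g', h')) = 1) \<and>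
     (\<forall>g\<in>?V. \<forall>g'\<in>?V. \<forall>h\<in>?W. \<forall>h'\<in>?W.
        (g = g') \<noteq> (h = h') \<or> ?A g g' \<noteq> ?B h h' \<longrightarrow> M (g, h) (g', h') = 0)"
  proof (rule cospectral_psd_matrix[OF SG SH spec neV neW adjacency_01 adjacency_01])
    show "(\<Sum>y\<in>?V. ?A x y) = of_real (real (a 2))" if "x \<in> ?V" for x
      using adjacency_regular[OF G that a[OF that]] by simp
    show "(\<Sum>y\<in>?W. ?B x y) = of_real (real (a 2))" if "x \<in> ?W" for x
      using adjacency_regular[OF H that a'[OF that]] by (simp add: valency)
    show "f x = f y"
      if "\<And>x y. x \<in> ?V \<Longrightarrow> y \<in> ?V \<Longrightarrow> ?A x y = 1 \<Longrightarrow> f x = f y" "x \<in> ?V" "y \<in> ?V"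
      for f :: "'a \<Rightarrow> complex" and x y
      using connected_constant[OF connG G, of f x y] that by blast
    show "f x = f y"
      if "\<And>x y. x \<in> ?W \<Longrightarrow> y \<in> ?W \<Longrightarrow> ?B x y = 1 \<Longrightarrow> f x = f y" "x \<in> ?W" "y \<in> ?W"
      for f :: "'b \<Rightarrow> complex" and x y
      using connected_constant[OF connH H, of f x y] that by blast
    show "\<exists>a. \<forall>x\<in>?V. kernel_power ?V ?A l x x = a" for l using a by blast
    show "\<exists>a. \<forall>x\<in>?W. kernel_power ?W ?B l x x = a" for l using a' by blast
    show "\<exists>b. \<forall>x\<in>?V. \<forall>y\<in>?V. ?A x y = 1 \<longrightarrow> kernel_power ?V ?A l x y = b" for l
      using regG unfolding one_walk_regular_iff[OF G.pair_finite_verts] by blast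
    show "\<exists>b. \<forall>x\<in>?W. \<forall>y\<in>?W. ?B x y = 1 \<longrightarrow> kernel_power ?W ?B l x y = b" for l
      using regH unfolding one_walk_regular_iff[OF H.pair_finite_verts] by blast
  qed
  then show ?thesis
    unfolding psd_isomorphic_def rel_eq_iff[OF G H] by (simp only: de_Morgan_conj)
qed

theorem theorem5p9:
  fixes G :: "'a pair_pre_digraph" and H :: "'b pair_pre_digraph"
  assumes "pair_graph G" and "Digraph_Component.connected (with_proj G)" and "one_walk_regular G"
    and "pair_graph H"
  shows "G \<cong>\<^sub>S\<^sub>+ H \<longleftrightarrow>
    Digraph_Component.connected (with_proj H) \<and> one_walk_regular H \<and> cospectral G H"
  using psd_isomorphic_imp[OF assms] cospectral_imp_psd_isomorphic[OF assms] by blast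

end
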